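(* Let $K$ be a field, $n\ge 1$, let $\widehat{X}=(x_{ij})$ be the generic $(n+1)\times n$ matrix and $Y=(y_1,\dots,y_n)^T$ the generic column matrix, and let $\widehat{R}=K[x_{ij},y_j\mid 1\le i\le n+1,\ 1\le j\le n]$. Consider the lexicographic monomial order on $\widehat{R}$ induced by $y_1>y_2>\cdots>y_n>x_{11}>x_{12}>\cdots>x_{(n+1),(n-1)}>x_{(n+1),n}$ (the $x_{ij}$ ordered row by row). For every $1\le k\le n$, the set $G_k=\bigcup_{i=k}^{n}\widetilde{S}_i$ is a reduced Gröbner basis of the ideal $\widetilde{I}_k$ of $\widehat{R}$. In particular, $G_1$ is a reduced Gröbner basis of $\widetilde{I}_1=I_1(\widehat{X}Y)$.
   Context: All $x_{ij}$ and $y_j$ are independent indeterminates. $I_1(\widehat{X}Y)$ is the ideal generated by the entries of the $(n+1)\times 1$ matrix $\widehat{X}Y$. For $1\le k\le n$, $C_k$ is the set of tuples $\mathbf{a}=(a_1,\dots,a_k)$ of integers with $1\le a_1<\cdots<a_k\le n+1$. $[a_1,\dots,a_k\mid b_1,\dots,b_k]$ denotes the determinant of the submatrix of $\widehat{X}$ with rows $a_1,\dots,a_k$ and columns $b_1,\dots,b_k$. For $\mathbf{a}\in C_k$ put $\widetilde{X^{\mathbf{a}}}=\sum_{m=k}^{n}[a_1,\dots,a_k\mid 1,\dots,k-1,m]\,y_m$. Then $\widetilde{S}_k=\{\widetilde{X^{\mathbf{a}}} : \mathbf{a}\in C_k\}$ and $\widetilde{I}_k$ is the ideal of $\widehat{R}$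 generated by $\widetilde{S}_k$. *)

theory Defs
  imports
    "HOL-Library.Poly_Mapping"
    "HOL-Algebra.Ideal"
    "Jordan_Normal_Form.Determinant"
begin

section \<open>Polynomial rings in a prescribed set of variables\<close>

text \<open>A monomial is its finitely supported exponent function, a polynomial a finitely
  supported coefficient function on monomials; multiplication is the convolution product of
  \<open>Poly_Mapping\<close>.\<close>

type_synonym 'v monom = "'v \<Rightarrow>\<^sub>0 nat"
type_synonym ('v, 'a) mpoly = "'v monom \<Rightarrow>\<^sub>0 'a"

definition indet :: "'v \<Rightarrow> ('v, 'a::comm_ring_1) mpoly" where
  "indet v = Poly_Mapping.single (Poly_Mapping.single v 1) 1"

definition mpoly_ring :: "'v set \<Rightarrow> ('v, 'a::comm_ring_1) mpoly ring" where
  "mpoly_ring V =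
     \<lparr>carrier = {p. \<forall>m\<in>Poly_Mapping.keys p. Poly_Mapping.keys m \<subseteq> V},
      monoid.mult = (*), one = 1, zero = 0, add = (+)\<rparr>"

text \<open>Since \<open>genideal\<close> intersects all ideals above a set, it is only meaningful over an
  actual ring.\<close>

lemma mpoly_ring_cring: "cring (mpoly_ring V :: ('v, 'a::comm_ring_1) mpoly ring)"
proof (rule cringI)
  show "abelian_group (mpoly_ring V :: ('v, 'a) mpoly ring)"
  proof (rule abelian_groupI)
    fix x y :: "('v, 'a) mpoly"
    assume "x \<in> carrier (mpoly_ring V)" "y \<in> carrier (mpoly_ring V)"
    then show "x \<oplus>\<^bsub>mpoly_ring V\<^esub> y \<in> carrier (mpoly_ring V)"
      using Poly_Mapping.keys_add[of x y] by (auto simp: mpoly_ring_def)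
  next
    fix x :: "('v, 'a) mpoly"
    assume "x \<in> carrier (mpoly_ring V)"
    then show "\<exists>y\<in>carrier (mpoly_ring V). y \<oplus>\<^bsub>mpoly_ring V\<^esub> x = \<zero>\<^bsub>mpoly_ring V\<^esub>"
      by (intro bexI[of _ "- x"]) (auto simp: mpoly_ring_def)
  qed (auto simp: mpoly_ring_def ac_simps)
next
  show "Group.comm_monoid (mpoly_ring V :: ('v, 'a) mpoly ring)"
  proof (rule comm_monoidI)
    fix x y :: "('v, 'a) mpoly"
    assume xy: "x \<in> carrier (mpoly_ring V)" "y \<in> carrier (mpoly_ring V)"
    have "Poly_Mapping.keys m \<subseteq> V" if m: "m \<in> Poly_Mapping.keys (x * y)" for m
    proof -
      from m obtain a b where "m = a + b" "a \<in> Poly_Mapping.keys x" "b \<in> Poly_Mapping.keys y"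
        using Poly_Mapping.keys_mult[of x y] by blast
      then show ?thesis
        using xy Poly_Mapping.keys_add[of a b] by (fastforce simp: mpoly_ring_def)
    qed
    then show "x \<otimes>\<^bsub>mpoly_ring V\<^esub> y \<in> carrier (mpoly_ring V)"
      by (simp add: mpoly_ring_def)
  qed (auto simp: mpoly_ring_def ac_simps)
next
  fix x y z :: "('v, 'a) mpoly"
  show "(x \<oplus>\<^bsub>mpoly_ring V\<^esub> y) \<otimes>\<^bsub>mpoly_ring V\<^esub> z
      = x \<otimes>\<^bsub>mpoly_ring V\<^esub> z \<oplus>\<^bsub>mpoly_ring V\<^esub> y \<otimes>\<^bsub>mpoly_ring V\<^esub> z"
    by (simp add: mpoly_ring_def algebra_simps)
qed


section \<open>Reduced Groebner bases for the lexicographic order\<close>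

text \<open>The order of \<open>Poly_Mapping\<close> on monomials over linearly ordered variables compares
  exponents at the \<^emph>\<open>least\<close> variable where they differ. So it is the lexicographic monomial
  order in which variables that are smaller in the order of \<open>'v\<close> are larger as monomials.\<close>

lemma monom_less_iff:
  fixes s t :: "'v::linorder monom"
  shows "s < t \<longleftrightarrow> (\<exists>v. Poly_Mapping.lookup s v < Poly_Mapping.lookup t v \<and>
    (\<forall>w<v. Poly_Mapping.lookup s w = Poly_Mapping.lookup t w))"
  by transfer (simp add: less_fun_def)

definition lead_monom :: "('v::linorder, 'a::zero) mpoly \<Rightarrow> 'v monom" where
  "lead_monom p = Max (Poly_Mapping.keys p)"

definition lead_coef :: "('v::linorder, 'a::zero) mpoly \<Rightarrow> 'a" where
  "lead_coef p = Poly_Mapping.lookup p (lead_monom p)"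

text \<open>The leading term of the zero polynomial is \<open>0\<close>.\<close>

definition lead_term :: "('v::linorder, 'a::zero) mpoly \<Rightarrow> ('v, 'a) mpoly" where
  "lead_term p = Poly_Mapping.single (lead_monom p) (lead_coef p)"

definition groebner_basis ::
  "'v::linorder set \<Rightarrow> ('v, 'a::field) mpoly set \<Rightarrow> ('v, 'a) mpoly set \<Rightarrow> bool" where
  "groebner_basis V I G \<longleftrightarrow>
     ideal I (mpoly_ring V) \<and> finite G \<and> G \<subseteq> I \<and>
     Idl\<^bsub>mpoly_ring V\<^esub> (lead_term ` G) = Idl\<^bsub>mpoly_ring V\<^esub> (lead_term ` I)"

definition reduced_groebner_basis ::
  "'v::linorder set \<Rightarrow> ('v, 'a::field) mpoly set \<Rightarrow> ('v, 'a) mpoly set \<Rightarrow> bool" where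
  "reduced_groebner_basis V I G \<longleftrightarrow>
     groebner_basis V I G \<and>
     (\<forall>g\<in>G. lead_coef g = 1 \<and>
        (\<forall>m\<in>Poly_Mapping.keys g.
           Poly_Mapping.single m 1 \<notin> Idl\<^bsub>mpoly_ring V\<^esub> (lead_term ` (G - {g}))))"


section \<open>The generic matrices and the ideals\<close>

datatype var = Y nat | X nat nat

text \<open>In the order below \<open>Y 1 < Y 2 < \<dots> < X 1 1 < X 1 2 < \<dots> < X 2 1 < \<dots>\<close>, which
  induces the lexicographic monomial order with
  \<open>y\<^sub>1 > y\<^sub>2 > \<dots> > x\<^sub>1\<^sub>1 > x\<^sub>1\<^sub>2 > \<dots> > x\<^sub>2\<^sub>1 > \<dots>\<close>.\<close>

instantiation var :: linorder
begin

fun less_var :: "var \<Rightarrow> var \<Rightarrow> bool" where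
  "Y j < Y j' \<longleftrightarrow> j < j'"
| "Y j < X i' j' \<longleftrightarrow> True"
| "X i j < Y j' \<longleftrightarrow> False"
| "X i j < X i' j' \<longleftrightarrow> i < i' \<or> (i = i' \<and> j < j')"

definition less_eq_var :: "var \<Rightarrow> var \<Rightarrow> bool" where
  "u \<le> v \<longleftrightarrow> u < v \<or> u = (v::var)"

instance
proof
  fix u v w :: var
  show "u < v \<longleftrightarrow> u \<le> v \<and> \<not> v \<le> u"
    by (cases u; cases v) (auto simp: less_eq_var_def)
  show "u \<le> u"
    by (simp add: less_eq_var_def)
  show "u \<le> w" if "u \<le> v" "v \<le> w"
    using that by (cases u; cases v; cases w) (auto simp: less_eq_var_def)
  show "u = v" if "u \<le> v" "v \<le> u"
    using that by (cases u; cases v) (auto simp: less_eq_var_def)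
  show "u \<le> v \<or> v \<le> u"
    by (cases u; cases v) (auto simp: less_eq_var_def)
qed

end

definition vars :: "nat \<Rightarrow> var set" where
  "vars n = {X i j | i j. i \<in> {1..n+1} \<and> j \<in> {1..n}} \<union> {Y j | j. j \<in> {1..n}}"

abbreviation Rhat :: "nat \<Rightarrow> (var, 'a::comm_ring_1) mpoly ring" where
  "Rhat n \<equiv> mpoly_ring (vars n)"

text \<open>Matrices are indexed from \<open>0\<close>, indeterminates from \<open>1\<close>.\<close>

definition Xhat :: "nat \<Rightarrow> (var, 'a::comm_ring_1) mpoly mat" where
  "Xhat n = mat (n + 1) n (\<lambda>(i, j). indet (X (i + 1) (j + 1)))"

definition Ymat :: "nat \<Rightarrow> (var, 'a::comm_ring_1) mpoly mat" where
  "Ymat n = mat n 1 (\<lambda>(j, _). indet (Y (j + 1)))"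

definition I1_XY :: "nat \<Rightarrow> (var, 'a::comm_ring_1) mpoly set" where
  "I1_XY n = Idl\<^bsub>Rhat n\<^esub> (elements_mat (Xhat n * Ymat n))"

text \<open>\<open>minor n as bs\<close> is \<open>[as | bs]\<close>; the lists contain row and column numbers counted from
  \<open>1\<close>.\<close>

definition minor :: "nat \<Rightarrow> nat list \<Rightarrow> nat list \<Rightarrow> (var, 'a::comm_ring_1) mpoly" where
  "minor n as bs =
     det (mat (length as) (length bs) (\<lambda>(i, j). Xhat n $$ (as ! i - 1, bs ! j - 1)))"

definition C :: "nat \<Rightarrow> nat \<Rightarrow> nat list set" where
  "C n k = {as. length as = k \<and> sorted_wrt (<) as \<and> set as \<subseteq> {1..n+1}}"

definition Xtilde :: "nat \<Rightarrow> nat \<Rightarrow> nat list \<Rightarrow> (var, 'a::comm_ring_1) mpoly" where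
  "Xtilde n k as = (\<Sum>m=k..n. minor n as ([1..<k] @ [m]) * indet (Y m))"

definition Stilde :: "nat \<Rightarrow> nat \<Rightarrow> (var, 'a::comm_ring_1) mpoly set" where
  "Stilde n k = Xtilde n k ` C n k"

definition Itilde :: "nat \<Rightarrow> nat \<Rightarrow> (var, 'a::comm_ring_1) mpoly set" where
  "Itilde n k = Idl\<^bsub>Rhat n\<^esub> (Stilde n k)"

definition Gset :: "nat \<Rightarrow> nat \<Rightarrow> (var, 'a::comm_ring_1) mpoly set" where
  "Gset n k = (\<Union>i\<in>{k..n}. Stilde n i)"

end

theory Submission
  imports Defs
begin

text \<open>
  The polynomials \<open>Xtilde n k as\<close> are the maximal minors of the matrix with columns
  \<open>X\<^sup>1, \<dots>, X\<^bsup>k-1\<^esup>, XY\<close>. Expanding along column \<open>k\<close> shows that the ideals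
  \<open>Itilde n k\<close> decrease with \<open>k\<close> (\<open>Xtilde_Suc\<close>), so \<open>Gset n k\<close> lies in \<open>Itilde n k\<close>. The
  leading monomial of \<open>Xtilde n k as\<close> is \<open>y\<^sub>k\<close> times the diagonal of the minor with columns
  \<open>1, \<dots>, k\<close> (\<open>lead_Xtilde\<close>), and comparing rows and columns shows that the basis is reduced
  (\<open>lead_Xtilde_dvd_key\<close>).

  It remains to see that the leading monomial \<open>u\<close> of a nonzero \<open>f\<close> in \<open>Itilde n k\<close> is a multiple of
  one of these monomials (\<open>lead_monom_Itilde\<close>). Instead of reducing S-polynomials, the proof
  constructs a point at which all of \<open>Itilde n k\<close> vanishes, but at which \<open>f\<close> cannot vanish if \<open>u\<close>
  is no such multiple. The coordinates of the point are Laurent polynomials over \<open>K\<close> in the variables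
  of \<open>vars n\<close>, ordered lexicographically. Suppose that \<open>u\<close> is not a multiple, and choose greedily
  rows \<open>r 1 < \<dots> < r t\<close> such that \<open>x\<^sub>i\<^sub>d\<close> with \<open>i = r d\<close> divides \<open>u\<close> for all \<open>d \<le> t\<close>. Then
  \<open>y\<^sub>k, \<dots>, y\<^sub>t\<close> do not divide \<open>u\<close>, and in each other row the variable in the column where
  the greedy choice is searching does not divide \<open>u\<close> either. So each row has a pivot column, and the
  equation of that row in \<open>XY = 0\<close> can be solved for the pivot entry, after the coordinates
  \<open>y\<^sub>1, \<dots>, y\<^sub>t\<close> have been given monomial values that make this consistent with the
  leading exponents of the chosen rows (locale \<open>staircase\<close>). Since \<open>u\<close> may contain \<open>y\<^sub>j\<close> with
  \<open>j < k\<close>, which do not occur in the generators of \<open>Itilde n k\<close>, these coordinates are reset to the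
  variables themselves (\<open>free_point\<close>).

  The variables of \<open>u\<close> then take values with their own exponents as leading exponents, while each
  other variable takes a value that is not larger than \<open>1\<close> as far as larger variables are concerned.
  A monomial smaller than \<open>u\<close> differs from \<open>u\<close> first at a variable of \<open>u\<close>, so its value has all
  exponents smaller than \<open>u\<close>. The value of \<open>f\<close> therefore has a nonzero coefficient at exponent \<open>u\<close>
  (\<open>poly_eval_nonzero\<close>), a contradiction.
\<close>

section \<open>Ideals and Groebner bases in polynomial rings\<close>

lemma carrier_mpoly_ring:
  "p \<in> carrier (mpoly_ring V) \<longleftrightarrow> (\<forall>m\<in>Poly_Mapping.keys p. Poly_Mapping.keys m \<subseteq> V)"
  by (simp add: mpoly_ring_def)

lemma mpoly_ring_ring: "ring (mpoly_ring V :: ('v, 'a::comm_ring_1) mpoly ring)"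
  using mpoly_ring_cring by (rule cring.axioms)

lemma a_inv_mpoly_ring:
  fixes p :: "('v, 'a::comm_ring_1) mpoly"
  assumes "p \<in> carrier (mpoly_ring V)"
  shows "\<ominus>\<^bsub>mpoly_ring V\<^esub> p = - p"
proof -
  interpret ring "mpoly_ring V :: ('v, 'a) mpoly ring" by (rule mpoly_ring_ring)
  have "- p \<in> carrier (mpoly_ring V)" using assms by (simp add: carrier_mpoly_ring)
  moreover have "- p \<oplus>\<^bsub>mpoly_ring V\<^esub> p = \<zero>\<^bsub>mpoly_ring V\<^esub>" by (simp add: mpoly_ring_def)
  ultimately show ?thesis using assms by (intro minus_equality)
qed

text \<open>Closure under negation is multiplication by the ring element \<open>-1\<close>.\<close>

lemma ideal_mpoly_ringI:
  fixes I :: "('v, 'a::comm_ring_1) mpoly set"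
  assumes "I \<subseteq> carrier (mpoly_ring V)" "0 \<in> I"
    and add: "\<And>p q. p \<in> I \<Longrightarrow> q \<in> I \<Longrightarrow> p + q \<in> I"
    and mult: "\<And>p q. p \<in> I \<Longrightarrow> q \<in> carrier (mpoly_ring V) \<Longrightarrow> q * p \<in> I"
  shows "ideal I (mpoly_ring V)"
proof (rule idealI)
  show "ring (mpoly_ring V :: ('v, 'a) mpoly ring)" by (rule mpoly_ring_ring)
  have neg: "- p \<in> I" if "p \<in> I" for p
  proof -
    have "- 1 \<in> carrier (mpoly_ring V :: ('v, 'a) mpoly ring)" by (simp add: carrier_mpoly_ring)
    from mult[OF that this] show ?thesis by simp
  qed
  have inv: "inv\<^bsub>add_monoid (mpoly_ring V)\<^esub> p = - p" if "p \<in> I" for p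
    using a_inv_mpoly_ring[of p V] that assms(1) unfolding a_inv_def by blast
  show "subgroup I (add_monoid (mpoly_ring V))"
    using assms neg inv by unfold_locales (auto simp: mpoly_ring_def)
  show "x \<otimes>\<^bsub>mpoly_ring V\<^esub> a \<in> I" "a \<otimes>\<^bsub>mpoly_ring V\<^esub> x \<in> I"
    if "a \<in> I" "x \<in> carrier (mpoly_ring V)" for a x
    using mult[OF that] by (simp_all add: mpoly_ring_def mult.commute)
qed

lemma ideal_mpoly_ringD:
  fixes I :: "('v, 'a::comm_ring_1) mpoly set"
  assumes "ideal I (mpoly_ring V)"
  shows "p \<in> I \<Longrightarrow> p \<in> carrier (mpoly_ring V)" "0 \<in> I"
    "p \<in> I \<Longrightarrow> q \<in> I \<Longrightarrow> p + q \<in> I"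
    "p \<in> I \<Longrightarrow> q \<in> carrier (mpoly_ring V) \<Longrightarrow> q * p \<in> I"
proof -
  interpret ideal I "mpoly_ring V" by fact
  show "p \<in> I \<Longrightarrow> p \<in> carrier (mpoly_ring V)" by (rule a_Hcarr)
  show "0 \<in> I" using additive_subgroup.zero_closed[OF is_additive_subgroup]
    by (simp add: mpoly_ring_def)
  show "p \<in> I \<Longrightarrow> q \<in> I \<Longrightarrow> p + q \<in> I" using additive_subgroup.a_closed[OF is_additive_subgroup]
    by (simp add: mpoly_ring_def)
  show "p \<in> I \<Longrightarrow> q \<in> carrier (mpoly_ring V) \<Longrightarrow> q * p \<in> I" using I_l_closed[of p q]
    by (simp add: mpoly_ring_def)
qed

lemma ideal_sum:
  fixes I :: "('v, 'a::comm_ring_1) mpoly set"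
  assumes "ideal I (mpoly_ring V)" "\<And>i. i \<in> A \<Longrightarrow> f i \<in> I"
  shows "sum f A \<in> I"
  using assms(2) ideal_mpoly_ringD(2,3)[OF assms(1)] by (induction A rule: infinite_finite_induct) auto

lemma Idl_mpoly_ring:
  fixes S :: "('v, 'a::comm_ring_1) mpoly set"
  assumes "S \<subseteq> carrier (mpoly_ring V)"
  shows "ideal (Idl\<^bsub>mpoly_ring V\<^esub> S) (mpoly_ring V)" "S \<subseteq> Idl\<^bsub>mpoly_ring V\<^esub> S"
  using ring.genideal_ideal[OF mpoly_ring_ring assms] ring.genideal_self[OF mpoly_ring_ring assms]
  by simp_all

lemma Idl_mpoly_ring_minimal:
  fixes I :: "('v, 'a::comm_ring_1) mpoly set"
  assumes "ideal I (mpoly_ring V)" "S \<subseteq> I"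
  shows "Idl\<^bsub>mpoly_ring V\<^esub> S \<subseteq> I"
  using ring.genideal_minimal[OF mpoly_ring_ring assms] .

text \<open>Membership in a monomial ideal is decided term by term. Here \<open>M\<close> is a set of
  monomials, and \<open>s\<close> divides \<open>m\<close> if \<open>m = s + d\<close> for some \<open>d\<close>.\<close>

lemma ideal_monomial_multiples:
  "ideal {p \<in> carrier (mpoly_ring V). \<forall>m\<in>Poly_Mapping.keys p. \<exists>s\<in>M. \<exists>d. m = s + d}
     (mpoly_ring V :: ('v, 'a::comm_ring_1) mpoly ring)"
proof (rule ideal_mpoly_ringI, safe)
  interpret cring "mpoly_ring V :: ('v, 'a) mpoly ring" by (rule mpoly_ring_cring)
  show "(0 :: ('v, 'a) mpoly) \<in> carrier (mpoly_ring V)" by (simp add: carrier_mpoly_ring)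
  show "\<exists>s\<in>M. \<exists>d. m = s + d" if "m \<in> Poly_Mapping.keys (0 :: ('v, 'a) mpoly)" for m
    using that by simp
  fix p q :: "('v, 'a) mpoly"
  assume p: "p \<in> carrier (mpoly_ring V)" "\<forall>m\<in>Poly_Mapping.keys p. \<exists>s\<in>M. \<exists>d. m = s + d"
  assume q: "q \<in> carrier (mpoly_ring V)"
  show "p + q \<in> carrier (mpoly_ring V)" using a_closed[OF p(1) q] by (simp add: mpoly_ring_def)
  show "q * p \<in> carrier (mpoly_ring V)" using m_closed[OF q p(1)] by (simp add: mpoly_ring_def)
  show "\<exists>s\<in>M. \<exists>d. m = s + d" if m: "m \<in> Poly_Mapping.keys (q * p)" for m
  proof -
    obtain a b where "m = a + b" "b \<in> Poly_Mapping.keys p" using m keys_mult[of q p] by blast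
    with p(2) obtain s d where "s \<in> M" "m = a + (s + d)" by metis
    then show ?thesis by (intro bexI[of _ s] exI[of _ "a + d"]) (simp_all add: ac_simps)
  qed
  show "\<exists>s\<in>M. \<exists>d. m = s + d"
    if "\<forall>m\<in>Poly_Mapping.keys q. \<exists>s\<in>M. \<exists>d. m = s + d" "m \<in> Poly_Mapping.keys (p + q)" for m
    using that p(2) keys_add[of p q] by auto
qed

lemma keys_add_monom: "Poly_Mapping.keys (s + d :: 'v monom) = Poly_Mapping.keys s \<union> Poly_Mapping.keys d"
  by (auto simp: in_keys_iff lookup_add)

lemma lead_term_in_carrier:
  assumes "p \<in> carrier (mpoly_ring V)"
  shows "lead_term p \<in> carrier (mpoly_ring V)"
proof (cases "p = 0")
  case False
  then have "lead_monom p \<in> Poly_Mapping.keys p"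
    unfolding lead_monom_def by (intro Max_in) auto
  with assms show ?thesis by (auto simp: carrier_mpoly_ring lead_term_def)
qed (simp add: carrier_mpoly_ring lead_term_def lead_coef_def)

lemma monomial_in_Idl_lead_terms_iff:
  fixes G :: "('v::linorder, 'a::field) mpoly set"
  assumes G: "G \<subseteq> carrier (mpoly_ring V)" and lc: "\<And>g. g \<in> G \<Longrightarrow> lead_coef g = 1"
    and m: "Poly_Mapping.keys m \<subseteq> V" and c: "c \<noteq> 0"
  shows "Poly_Mapping.single m c \<in> Idl\<^bsub>mpoly_ring V\<^esub> (lead_term ` G)
     \<longleftrightarrow> (\<exists>g\<in>G. \<exists>d. m = lead_monom g + d)"
proof
  have "lead_term ` G \<subseteq> {p \<in> carrier (mpoly_ring V).
      \<forall>m\<in>Poly_Mapping.keys p. \<exists>s\<in>lead_monom ` G. \<exists>d. m = s + d}" (is "_ \<subseteq> ?I")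
  proof clarsimp
    fix g assume "g \<in> G"
    moreover have "m \<in> Poly_Mapping.keys (lead_term g) \<Longrightarrow> m = lead_monom g + 0" for m
      by (auto simp: lead_term_def split: if_splits)
    ultimately show "lead_term g \<in> carrier (mpoly_ring V) \<and>
        (\<forall>m\<in>Poly_Mapping.keys (lead_term g). \<exists>s\<in>G. \<exists>d. m = lead_monom s + d)"
      using lead_term_in_carrier G by blast
  qed
  from Idl_mpoly_ring_minimal[OF ideal_monomial_multiples this]
  show "Poly_Mapping.single m c \<in> Idl\<^bsub>mpoly_ring V\<^esub> (lead_term ` G)
     \<Longrightarrow> \<exists>g\<in>G. \<exists>d. m = lead_monom g + d" using c by auto
next
  assume "\<exists>g\<in>G. \<exists>d. m = lead_monom g + d"
  then obtain g d where g: "g \<in> G" and d: "m = lead_monom g + d" by blast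
  have sub: "lead_term ` G \<subseteq> carrier (mpoly_ring V)" using G lead_term_in_carrier by blast
  have "Poly_Mapping.single d c * lead_term g = Poly_Mapping.single m c"
    using lc[OF g] by (simp add: lead_term_def mult_single d add.commute)
  moreover have "Poly_Mapping.single d c \<in> carrier (mpoly_ring V)"
    using m d by (simp add: carrier_mpoly_ring keys_add_monom)
  ultimately show "Poly_Mapping.single m c \<in> Idl\<^bsub>mpoly_ring V\<^esub> (lead_term ` G)"
    using ideal_mpoly_ringD(4)[OF Idl_mpoly_ring(1)[OF sub]] Idl_mpoly_ring(2)[OF sub] g
    by (metis image_subset_iff)
qed

text \<open>With leading coefficients \<open>1\<close>, both parts of the definition reduce to divisibility of monomials,
  because membership in an ideal of leading terms does.\<close>

lemma reduced_groebner_basisI: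
  fixes I :: "('v::linorder, 'a::field) mpoly set"
  assumes I: "ideal I (mpoly_ring V)" and fin: "finite G" and GI: "G \<subseteq> I"
    and lc: "\<And>g. g \<in> G \<Longrightarrow> lead_coef g = 1"
    and div: "\<And>f. f \<in> I \<Longrightarrow> f \<noteq> 0 \<Longrightarrow> \<exists>g\<in>G. \<exists>d. lead_monom f = lead_monom g + d"
    and red: "\<And>g h m d. g \<in> G \<Longrightarrow> h \<in> G \<Longrightarrow> m \<in> Poly_Mapping.keys g \<Longrightarrow> m = lead_monom h + d \<Longrightarrow> g = h"
  shows "reduced_groebner_basis V I G"
proof -
  have I_carr: "I \<subseteq> carrier (mpoly_ring V)" using ideal_mpoly_ringD(1)[OF I] by blast
  then have G_carr: "G \<subseteq> carrier (mpoly_ring V)" using GI by blast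
  have lG: "lead_term ` G \<subseteq> carrier (mpoly_ring V)" and lI: "lead_term ` I \<subseteq> carrier (mpoly_ring V)"
    using G_carr I_carr lead_term_in_carrier by blast+
  have "lead_term f \<in> Idl\<^bsub>mpoly_ring V\<^esub> (lead_term ` G)" if f: "f \<in> I" for f
  proof (cases "f = 0")
    case True
    then have "lead_term f = 0" by (simp add: lead_term_def lead_coef_def)
    then show ?thesis using ideal_mpoly_ringD(2)[OF Idl_mpoly_ring(1)[OF lG]] by simp
  next
    case False
    then have k: "lead_monom f \<in> Poly_Mapping.keys f"
      unfolding lead_monom_def by (intro Max_in) auto
    moreover have "f \<in> carrier (mpoly_ring V)" using f I_carr by blast
    ultimately have "Poly_Mapping.keys (lead_monom f) \<subseteq> V" "lead_coef f \<noteq> 0"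
      unfolding carrier_mpoly_ring lead_coef_def in_keys_iff[symmetric] by blast+
    from monomial_in_Idl_lead_terms_iff[OF G_carr lc this] div[OF f False]
    show ?thesis unfolding lead_term_def by blast
  qed
  then have "Idl\<^bsub>mpoly_ring V\<^esub> (lead_term ` I) \<subseteq> Idl\<^bsub>mpoly_ring V\<^esub> (lead_term ` G)"
    by (intro Idl_mpoly_ring_minimal[OF Idl_mpoly_ring(1)[OF lG]]) blast
  moreover have "Idl\<^bsub>mpoly_ring V\<^esub> (lead_term ` G) \<subseteq> Idl\<^bsub>mpoly_ring V\<^esub> (lead_term ` I)"
    using Idl_mpoly_ring(2)[OF lI] GI
    by (intro Idl_mpoly_ring_minimal[OF Idl_mpoly_ring(1)[OF lI]]) blast
  ultimately have "groebner_basis V I G"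
    using I fin GI by (auto simp: groebner_basis_def)
  moreover have "Poly_Mapping.single m 1 \<notin> Idl\<^bsub>mpoly_ring V\<^esub> (lead_term ` (G - {g}))"
    if g: "g \<in> G" and m: "m \<in> Poly_Mapping.keys g" for g m
  proof -
    have "g \<in> carrier (mpoly_ring V)" using g G_carr by blast
    then have "Poly_Mapping.keys m \<subseteq> V" using m unfolding carrier_mpoly_ring by blast
    then have "Poly_Mapping.single m 1 \<in> Idl\<^bsub>mpoly_ring V\<^esub> (lead_term ` (G - {g}))
        \<longleftrightarrow> (\<exists>h\<in>G - {g}. \<exists>d. m = lead_monom h + d)"
      using G_carr lc by (intro monomial_in_Idl_lead_terms_iff) auto
    then show ?thesis using red[OF g _ m] by blast
  qed
  ultimately show ?thesis using lc by (auto simp: reduced_groebner_basis_def)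
qed


section \<open>The terms of the polynomials in the basis\<close>

text \<open>The column numbers \<open>1, \<dots>, k - 1, m\<close>, indexed from \<open>0\<close>.\<close>

definition mcol :: "nat \<Rightarrow> nat \<Rightarrow> nat \<Rightarrow> nat" where
  "mcol k m j = (if j = k - 1 then m else j + 1)"

text \<open>The term that a permutation \<open>p\<close> contributes to the minor with columns \<open>1, \<dots>, k - 1, m\<close>,
  times \<open>y\<^sub>m\<close>. Each term of \<open>Xtilde n k as\<close> comes from one pair \<open>(m, p)\<close>. The pair with
  \<open>m = k\<close> and \<open>p\<close> the identity gives the leading monomial
  \<open>y\<^sub>k x\<^bsub>a\<^sub>1,1\<^esub> \<dots> x\<^bsub>a\<^sub>k,k\<^esub>\<close>.\<close>

definition xmonom :: "nat \<Rightarrow> nat list \<Rightarrow> nat \<Rightarrow> (nat \<Rightarrow> nat) \<Rightarrow> var monom" where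
  "xmonom k as m p =
     (\<Sum>i<k. Poly_Mapping.single (X (as ! i) (mcol k m (p i))) 1) + Poly_Mapping.single (Y m) 1"

lemma nth_mcol:
  assumes "j < k" shows "([1..<k] @ [m]) ! j = mcol k m j"
  using assms by (auto simp: mcol_def nth_append)

lemma in_C_nth:
  assumes "as \<in> C n k" "i < k"
  shows "1 \<le> as ! i" "as ! i \<le> n + 1"
proof -
  have "as ! i \<in> set as" using assms by (auto simp: C_def)
  then show "1 \<le> as ! i" "as ! i \<le> n + 1" using assms(1) by (auto simp: C_def)
qed

lemma in_C_nth_less:
  assumes "as \<in> C n k" "i < j" "j < k"
  shows "as ! i < as ! j"
  using assms by (auto simp: C_def sorted_wrt_iff_nth_less)

lemma in_C_nth_eq:
  assumes "as \<in> C n k" "i < k" "j < k" "as ! i = as ! j"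
  shows "i = j"
  using in_C_nth_less[OF assms(1)] assms(2-) by (metis less_irrefl linorder_neqE_nat)

lemma prod_single_one:
  "(\<Prod>i\<in>A. Poly_Mapping.single (f i) (1 :: 'b::comm_semiring_1))
     = Poly_Mapping.single (\<Sum>i\<in>A. f i :: 'v monom) 1"
  by (induction A rule: infinite_finite_induct) (auto simp: mult_single)

lemma minor_expand:
  assumes as: "as \<in> C n k" and len: "length bs = k"
    and bs: "\<And>j. j < k \<Longrightarrow> 1 \<le> bs ! j \<and> bs ! j \<le> n"
  shows "(minor n as bs :: (var, 'a::comm_ring_1) mpoly) =
    (\<Sum>p | p permutes {0..<k}. signof p *
       Poly_Mapping.single (\<Sum>i<k. Poly_Mapping.single (X (as ! i) (bs ! p i)) 1) 1)"
proof -
  have la: "length as = k" using as by (simp add: C_def)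
  have "(\<Prod>i = 0..<k. mat k k (\<lambda>(i, j). Xhat n $$ (as ! i - 1, bs ! j - 1)) $$ (i, p i)) =
      (Poly_Mapping.single (\<Sum>i<k. Poly_Mapping.single (X (as ! i) (bs ! p i)) 1) 1 :: (var, 'a) mpoly)"
    if p: "p permutes {0..<k}" for p
  proof -
    have "mat k k (\<lambda>(i, j). Xhat n $$ (as ! i - 1, bs ! j - 1)) $$ (i, p i) =
        (Poly_Mapping.single (Poly_Mapping.single (X (as ! i) (bs ! p i)) 1) 1 :: (var, 'a) mpoly)"
      if i: "i < k" for i
    proof -
      have pi: "p i < k" using permutes_in_image[OF p, of i] i by simp
      note b = in_C_nth[OF as i] bs[OF pi]
      have "as ! i - 1 < n + 1" "bs ! p i - 1 < n" using b by linarith+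
      then have "Xhat n $$ (as ! i - 1, bs ! p i - 1)
          = (indet (X (as ! i - 1 + 1) (bs ! p i - 1 + 1)) :: (var, 'a) mpoly)"
        by (simp add: Xhat_def)
      also have "as ! i - 1 + 1 = as ! i" using b by linarith
      also have "bs ! p i - 1 + 1 = bs ! p i" using b by linarith
      finally show ?thesis using i pi by (simp add: indet_def)
    qed
    then have "(\<Prod>i = 0..<k. mat k k (\<lambda>(i, j). Xhat n $$ (as ! i - 1, bs ! j - 1)) $$ (i, p i)) =
        (\<Prod>i<k. Poly_Mapping.single (Poly_Mapping.single (X (as ! i) (bs ! p i)) 1) (1::'a))"
      unfolding atLeast0LessThan by (intro prod.cong) simp_all
    then show ?thesis by (simp only: prod_single_one)
  qed
  then show ?thesis unfolding minor_def la len det_def'[OF mat_carrier]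
    by (intro sum.cong refl) (simp only: mem_Collect_eq)
qed

lemma signof_times_single:
  "signof p * Poly_Mapping.single m 1
     = (Poly_Mapping.single m (signof p) :: ('v, 'a::comm_ring_1) mpoly)"
  using single_of_int[of "sign p"] mult_single[of 0 "of_int (sign p)" m "1 :: 'a"] 
  by simp

lemma Xtilde_expand:
  assumes as: "as \<in> C n k" and k: "1 \<le> k" "k \<le> n"
  shows "(Xtilde n k as :: (var, 'a::comm_ring_1) mpoly) =
    (\<Sum>(m, p)\<in>{k..n} \<times> {p. p permutes {0..<k}}. Poly_Mapping.single (xmonom k as m p) (signof p))"
proof -
  have minor: "minor n as ([1..<k] @ [m]) * indet (Y m) =
     (\<Sum>p | p permutes {0..<k}. Poly_Mapping.single (xmonom k as m p) (signof p) :: (var, 'a) mpoly)"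
    if m: "m \<in> {k..n}" for m
  proof -
    let ?bs = "[1..<k] @ [m]"
    have len: "length ?bs = k" using k by simp
    have range: "1 \<le> ?bs ! j \<and> ?bs ! j \<le> n" if "j < k" for j
      using that m k unfolding nth_mcol[OF that] by (auto simp: mcol_def)
    have xm: "(\<Sum>i<k. Poly_Mapping.single (X (as ! i) (?bs ! p i)) (1::nat)) + Poly_Mapping.single (Y m) 1
         = xmonom k as m p" if p: "p permutes {0..<k}" for p
    proof -
      have "?bs ! p i = mcol k m (p i)" if "i < k" for i
        using permutes_in_image[OF p, of i] that by (intro nth_mcol) simp
      then show ?thesis unfolding xmonom_def
        by (intro arg_cong2[of _ _ _ _ "(+)"] sum.cong refl) (simp only: lessThan_iff)
    qed
    have "signof p * Poly_Mapping.single (\<Sum>i<k. Poly_Mapping.single (X (as ! i) (?bs ! p i)) 1) 1 * indet (Y m)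
       = (Poly_Mapping.single (xmonom k as m p) (signof p) :: (var, 'a) mpoly)"
      if p: "p permutes {0..<k}" for p
      unfolding signof_times_single indet_def mult_single mult_1_right xm[OF p] ..
    moreover have "(minor n as ?bs :: (var, 'a) mpoly) = (\<Sum>p | p permutes {0..<k}. signof p *
        Poly_Mapping.single (\<Sum>i<k. Poly_Mapping.single (X (as ! i) (?bs ! p i)) 1) 1)"
      by (rule minor_expand[OF as len]) (rule range)
    ultimately show ?thesis unfolding sum_distrib_right
      by (simp only: sum_distrib_right) (intro sum.cong refl, simp only: mem_Collect_eq)
  qed
  show ?thesis unfolding Xtilde_def sum.cartesian_product[symmetric]
    by (intro sum.cong refl) (rule minor)
qed

lemma keys_Xtilde:
  assumes "as \<in> C n k" "1 \<le> k" "k \<le> n"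
    and "mm \<in> Poly_Mapping.keys (Xtilde n k as :: (var, 'a::comm_ring_1) mpoly)"
  obtains m p where "k \<le> m" "m \<le> n" "p permutes {0..<k}" "mm = xmonom k as m p"
proof -
  have "\<exists>q\<in>{k..n} \<times> {p. p permutes {0..<k}}. mm \<in> Poly_Mapping.keys
      (case q of (m, p) \<Rightarrow> Poly_Mapping.single (xmonom k as m p) (signof p :: 'a))"
    using subsetD[OF keys_sum assms(4)[unfolded Xtilde_expand[OF assms(1-3)]]] by (rule UN_E) blast
  then obtain m p where mp: "m \<in> {k..n}" "p permutes {0..<k}"
    "mm \<in> Poly_Mapping.keys (Poly_Mapping.single (xmonom k as m p) (signof p :: 'a))" by auto
  from mp(3) have "mm = xmonom k as m p" by (simp split: if_splits)
  with mp(1,2) show thesis by (intro that[of m p]) simp_all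
qed

lemma lookup_sum_single:
  "Poly_Mapping.lookup (\<Sum>i<k. Poly_Mapping.single (f i) (1::nat)) v = card {i::nat. i < k \<and> f i = v}"
proof -
  have "Poly_Mapping.lookup (\<Sum>i<k. Poly_Mapping.single (f i) (1::nat)) v
      = (\<Sum>i<k. if f i = v then 1 else 0)"
    unfolding lookup_sum by (intro sum.cong) (auto simp: lookup_single)
  also have "\<dots> = (\<Sum>i\<in>{i \<in> {..<k}. f i = v}. 1)"
    by (rule sum.inter_filter[symmetric]) simp
  also have "\<dots> = card {i. i < k \<and> f i = v}" by simp
  finally show ?thesis .
qed

lemma lookup_xmonom_Y:
  "Poly_Mapping.lookup (xmonom k as m p) (Y j) = (if j = m then 1 else 0)"
  by (simp add: xmonom_def lookup_add lookup_sum lookup_single when_def)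

lemma lookup_xmonom_X:
  "Poly_Mapping.lookup (xmonom k as m p) (X i j) =
     card {d. d < k \<and> as ! d = i \<and> mcol k m (p d) = j}"
  unfolding xmonom_def lookup_add lookup_sum_single by (simp add: lookup_single)

lemma lookup_xmonom_X_nth:
  assumes as: "as \<in> C n k" and d: "d < k"
  shows "Poly_Mapping.lookup (xmonom k as m p) (X (as ! d) j) = (if mcol k m (p d) = j then 1 else 0)"
proof -
  have "{e. e < k \<and> as ! e = as ! d \<and> mcol k m (p e) = j} = (if mcol k m (p d) = j then {d} else {})"
    using in_C_nth_eq[OF as _ d] d by auto
  then show ?thesis by (simp add: lookup_xmonom_X)
qed

lemma lookup_xmonom_X_nonzero:
  assumes "Poly_Mapping.lookup (xmonom k as m p) (X i j) \<noteq> 0"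
  shows "\<exists>d<k. as ! d = i \<and> mcol k m (p d) = j"
proof (rule ccontr)
  assume "\<not> ?thesis"
  then have "{d. d < k \<and> as ! d = i \<and> mcol k m (p d) = j} = {}" by blast
  with assms show False by (simp only: lookup_xmonom_X card.empty simp_thms)
qed

abbreviation lead_xmonom :: "nat \<Rightarrow> nat list \<Rightarrow> var monom" where
  "lead_xmonom k as \<equiv> xmonom k as k id"

lemma mcol_diag: "j < k \<Longrightarrow> mcol k k j = j + 1"
  by (auto simp: mcol_def)

text \<open>A term with \<open>y\<^sub>m\<close>, \<open>m > k\<close>, is smaller than every term with \<open>y\<^sub>k\<close>. Among the latter the diagonal one is the largest: at the first row where a
  permutation differs from the identity, it moves to a column further to the right.\<close>

lemma xmonom_less_lead:
  assumes as: "as \<in> C n k" and k: "1 \<le> k" "k \<le> m" and p: "p permutes {0..<k}"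
    and ne: "m \<noteq> k \<or> p \<noteq> id"
  shows "xmonom k as m p < lead_xmonom k as"
proof (cases "m = k")
  case False
  then show ?thesis unfolding monom_less_iff
    using k by (intro exI[of _ "Y k"]) (auto simp: lookup_xmonom_Y elim!: less_var.elims)
next
  case mk: True
  with ne have "\<exists>d. p d \<noteq> d" by auto
  define e where "e = (LEAST d. p d \<noteq> d)"
  have pe: "p e \<noteq> e" unfolding e_def using \<open>\<exists>d. p d \<noteq> d\<close> by (rule LeastI_ex)
  have pd: "p d = d" if "d < e" for d using that not_less_Least unfolding e_def by blast
  have ek: "e < k" using pe p by (metis atLeastLessThan_iff not_le permutes_not_in zero_le)
  have pek: "p e < k" using permutes_in_image[OF p, of e] ek by simp
  have "p e > e"
  proof (rule ccontr)
    assume "\<not> e < p e"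
    with pe have "p e < e" by simp
    from pd[OF this] have "p (p e) = p e" .
    then have "p e = e" using permutes_inj[OF p] by (auto dest: injD)
    with pe show False by simp
  qed
  have "Poly_Mapping.lookup (xmonom k as k p) w = Poly_Mapping.lookup (lead_xmonom k as) w"
    if w: "w < X (as ! e) (e + 1)" for w
  proof (cases w)
    case (Y j) then show ?thesis by (simp add: lookup_xmonom_Y)
  next
    case (X i j)
    with w have ij: "i < as ! e \<or> (i = as ! e \<and> j < e + 1)" by simp
    have "as ! d = i \<and> mcol k k (p d) = j \<longleftrightarrow> as ! d = i \<and> mcol k k (id d) = j" if d: "d < k" for d
    proof (cases "d < e")
      case True then show ?thesis by (simp add: pd)
    next
      case False
      then have "as ! e \<le> as ! d" using in_C_nth_less[OF as, of e d] d by (cases "d = e") auto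
      then show ?thesis using ij d in_C_nth_eq[OF as d ek] \<open>e < p e\<close> pek
        by (auto simp: mcol_diag)
    qed
    then have "{d. d < k \<and> as ! d = i \<and> mcol k k (p d) = j} =
        {d. d < k \<and> as ! d = i \<and> mcol k k (id d) = j}" by blast
    then show ?thesis using X by (simp only: lookup_xmonom_X)
  qed
  moreover have "Poly_Mapping.lookup (xmonom k as k p) (X (as ! e) (e + 1)) = 0"
      "Poly_Mapping.lookup (lead_xmonom k as) (X (as ! e) (e + 1)) = 1"
    using pe ek pek by (simp_all add: lookup_xmonom_X_nth[OF as ek] mcol_diag)
  ultimately show ?thesis unfolding mk monom_less_iff
    by (intro exI[of _ "X (as ! e) (e + 1)"]) simp
qed

text \<open>No other term can cancel the diagonal one, since all others have strictly smaller monomials.\<close>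

lemma lookup_Xtilde_lead:
  assumes as: "as \<in> C n k" and k: "1 \<le> k" "k \<le> n"
  shows "Poly_Mapping.lookup (Xtilde n k as :: (var, 'a::comm_ring_1) mpoly) (lead_xmonom k as) = 1"
proof -
  have "Poly_Mapping.lookup (Poly_Mapping.single (xmonom k as (fst q) (snd q)) (signof (snd q)))
      (lead_xmonom k as) = (if q = (k, id) then 1 else (0::'a))"
    if q: "q \<in> {k..n} \<times> {p. p permutes {0..<k}}" for q
  proof (cases "q = (k, id)")
    case True then show ?thesis by simp
  next
    case False
    obtain m p where q': "q = (m, p)" by (cases q)
    have "xmonom k as m p < lead_xmonom k as"
      using q False q' k(1) by (intro xmonom_less_lead[OF as]) auto
    then show ?thesis using False q' by (auto simp: lookup_single when_def)
  qed
  then have "Poly_Mapping.lookup (Xtilde n k as :: (var, 'a) mpoly) (lead_xmonom k as) =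
      (\<Sum>q\<in>{k..n} \<times> {p. p permutes {0..<k}}. if q = (k, id) then 1 else 0)"
    unfolding Xtilde_expand[OF assms] by (simp add: lookup_sum case_prod_beta)
  also have "\<dots> = 1" using k by (simp add: permutes_id finite_permutations)
  finally show ?thesis .
qed

lemma lead_Xtilde:
  assumes as: "as \<in> C n k" and k: "1 \<le> k" "k \<le> n"
  shows "lead_monom (Xtilde n k as :: (var, 'a::comm_ring_1) mpoly) = lead_xmonom k as"
    and "lead_coef (Xtilde n k as :: (var, 'a) mpoly) = 1"
proof -
  note lk = lookup_Xtilde_lead[OF assms, where 'a = 'a]
  show 1: "lead_monom (Xtilde n k as :: (var, 'a) mpoly) = lead_xmonom k as"
    unfolding lead_monom_def
  proof (rule Max_eqI)
    show "lead_xmonom k as \<in> Poly_Mapping.keys (Xtilde n k as :: (var, 'a) mpoly)"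
      using lk by (simp add: in_keys_iff)
    fix mm assume "mm \<in> Poly_Mapping.keys (Xtilde n k as :: (var, 'a) mpoly)"
    then obtain m p where mp: "k \<le> m" "p permutes {0..<k}" "mm = xmonom k as m p"
      using keys_Xtilde[OF assms] by metis
    then show "mm \<le> lead_xmonom k as"
      using xmonom_less_lead[OF as k(1) mp(1,2)] by (cases "m = k \<and> p = id") auto
  qed simp
  show "lead_coef (Xtilde n k as :: (var, 'a) mpoly) = 1" unfolding lead_coef_def 1 by (rule lk)
qed

text \<open>A term \<open>y\<^sub>j \<dots>\<close> of \<open>Xtilde n k as\<close> has \<open>j \<ge> k\<close> and uses only the rows in \<open>as\<close>. If the
  leading monomial \<open>y\<^sub>l \<dots>\<close> with rows \<open>bs\<close> divides it, then \<open>j = l\<close> and \<open>bs\<close> is contained in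
  \<open>as\<close>, so \<open>l \<le> k \<le> j = l\<close>.\<close>

lemma lead_Xtilde_dvd_key:
  assumes as: "as \<in> C n k" "1 \<le> k" "k \<le> n" and bs: "bs \<in> C n l" "1 \<le> l" "l \<le> n"
    and mm: "mm \<in> Poly_Mapping.keys (Xtilde n k as :: (var, 'a::comm_ring_1) mpoly)"
    and dvd: "mm = lead_xmonom l bs + d"
  shows "k = l \<and> as = bs"
proof -
  obtain m p where mp: "k \<le> m" "m \<le> n" "p permutes {0..<k}" "mm = xmonom k as m p"
    using keys_Xtilde[OF as mm] by metis
  have le: "Poly_Mapping.lookup (lead_xmonom l bs) v \<le> Poly_Mapping.lookup (xmonom k as m p) v" for v
    using dvd mp(4) by (simp add: lookup_add)
  from le[of "Y l"] have ml: "m = l" by (auto simp: lookup_xmonom_Y split: if_splits)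
  have sub: "set bs \<subseteq> set as"
  proof
    fix b assume "b \<in> set bs"
    then obtain i where i: "i < l" "b = bs ! i" using bs by (auto simp: C_def in_set_conv_nth)
    have "0 < Poly_Mapping.lookup (lead_xmonom l bs) (X b (i + 1))"
      using i by (simp add: lookup_xmonom_X_nth[OF bs(1)] mcol_diag)
    with le[of "X b (i + 1)"] have "0 < Poly_Mapping.lookup (xmonom k as m p) (X b (i + 1))"
      by linarith
    then have "{d. d < k \<and> as ! d = b \<and> mcol k m (p d) = i + 1} \<noteq> {}"
      unfolding lookup_xmonom_X by (metis card.empty less_irrefl)
    then show "b \<in> set as" using as(1) by (auto simp: C_def in_set_conv_nth)
  qed
  have sd: "sorted as \<and> distinct as" "sorted bs \<and> distinct bs"
    using as(1) bs(1) by (auto simp: C_def strict_sorted_iff)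
  have card: "card (set as) = k" "card (set bs) = l"
    using as(1) bs(1) sd by (auto simp: C_def distinct_card)
  have "l \<le> k" using card_mono[OF _ sub] card by simp
  with ml mp(1) have "k = l" by simp
  moreover have "set as = set bs" using card_subset_eq[OF _ sub] card \<open>k = l\<close> by simp
  ultimately show ?thesis using sd sorted_distinct_set_unique by blast
qed


section \<open>Evaluation of polynomials in a group algebra\<close>

lemma monom_induct [case_names zero add]:
  fixes m :: "'v monom"
  assumes zero: "Q 0" and add: "\<And>m v. Q m \<Longrightarrow> Q (m + Poly_Mapping.single v 1)"
  shows "Q m"
proof (induction "\<Sum>v\<in>Poly_Mapping.keys m. Poly_Mapping.lookup m v" arbitrary: m)
  case 0
  then have "m = 0" by (auto simp: in_keys_iff intro!: poly_mapping_eqI)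
  with zero show ?case by simp
next
  case (Suc k)
  then obtain v where v: "v \<in> Poly_Mapping.keys m" by (metis Zero_not_Suc sum.neutral)
  define m' where "m' = m - Poly_Mapping.single v 1"
  have m: "m = m' + Poly_Mapping.single v 1"
    using v by (intro poly_mapping_eqI)
      (auto simp: m'_def lookup_add lookup_minus lookup_single in_keys_iff when_def)
  have sub: "Poly_Mapping.keys m' \<subseteq> Poly_Mapping.keys m" by (auto simp: m keys_add_monom)
  have "(\<Sum>x\<in>Poly_Mapping.keys m. Poly_Mapping.lookup m x)
      = (\<Sum>x\<in>Poly_Mapping.keys m. Poly_Mapping.lookup m' x)
        + (\<Sum>x\<in>Poly_Mapping.keys m. if x = v then 1 else 0)"
    unfolding sum.distrib[symmetric]
    by (intro sum.cong refl) (auto simp: m lookup_add lookup_single when_def)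
  also have "(\<Sum>x\<in>Poly_Mapping.keys m. if x = v then 1 else 0) = (1::nat)"
    using v by simp
  also have "(\<Sum>x\<in>Poly_Mapping.keys m. Poly_Mapping.lookup m' x)
      = (\<Sum>x\<in>Poly_Mapping.keys m'. Poly_Mapping.lookup m' x)"
    using sub by (intro sum.mono_neutral_right) (auto simp: in_keys_iff)
  finally have "k = (\<Sum>x\<in>Poly_Mapping.keys m'. Poly_Mapping.lookup m' x)" using Suc(2) by simp
  from add[OF Suc(1)[OF this]] show ?case using m by simp
qed

definition monom_eval :: "('v \<Rightarrow> 'b::comm_semiring_1) \<Rightarrow> 'v monom \<Rightarrow> 'b" where
  "monom_eval P m = (\<Prod>v\<in>Poly_Mapping.keys m. P v ^ Poly_Mapping.lookup m v)"

lemma monom_eval_superset: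
  assumes "finite A" "Poly_Mapping.keys m \<subseteq> A"
  shows "monom_eval P m = (\<Prod>v\<in>A. P v ^ Poly_Mapping.lookup m v)"
  unfolding monom_eval_def using assms
  by (intro prod.mono_neutral_left) (auto simp: in_keys_iff)

lemma monom_eval_zero [simp]: "monom_eval P 0 = 1"
  by (simp add: monom_eval_def)

lemma monom_eval_single: "monom_eval P (Poly_Mapping.single v 1) = P v"
  by (simp add: monom_eval_def)

lemma monom_eval_add: "monom_eval P (s + t) = monom_eval P s * monom_eval P t"
proof -
  let ?A = "Poly_Mapping.keys s \<union> Poly_Mapping.keys t"
  have "monom_eval P r = (\<Prod>v\<in>?A. P v ^ Poly_Mapping.lookup r v)"
    if "r \<in> {s, t, s + t}" for r
    using that by (intro monom_eval_superset) (auto simp: keys_add_monom)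
  then show ?thesis by (simp add: lookup_add power_add prod.distrib)
qed

text \<open>The value of a polynomial at a point whose coordinates are Laurent polynomials, that is,
  elements of the group algebra of the exponent group \<open>'g\<close>; scalars are embedded at exponent \<open>0\<close>.\<close>

definition poly_eval :: "('v \<Rightarrow> ('g::comm_monoid_add \<Rightarrow>\<^sub>0 'a)) \<Rightarrow> ('v, 'a::comm_ring_1) mpoly \<Rightarrow> 'g \<Rightarrow>\<^sub>0 'a" where
  "poly_eval P p =
     (\<Sum>m\<in>Poly_Mapping.keys p. Poly_Mapping.single 0 (Poly_Mapping.lookup p m) * monom_eval P m)"

lemma poly_eval_superset:
  assumes "finite A" "Poly_Mapping.keys p \<subseteq> A"
  shows "poly_eval P p = (\<Sum>m\<in>A. Poly_Mapping.single 0 (Poly_Mapping.lookup p m) * monom_eval P m)"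
  unfolding poly_eval_def using assms
  by (intro sum.mono_neutral_left) (auto simp: in_keys_iff)

lemma poly_eval_zero [simp]: "poly_eval P 0 = 0"
  by (simp add: poly_eval_def)

lemma poly_eval_single: "poly_eval P (Poly_Mapping.single m c) = Poly_Mapping.single 0 c * monom_eval P m"
  by (subst poly_eval_superset[of "{m}"]) auto

lemma poly_eval_indet: "poly_eval P (indet v) = P v"
  unfolding indet_def poly_eval_single monom_eval_single by simp

lemma poly_eval_add: "poly_eval P (p + q) = poly_eval P p + poly_eval P q"
proof -
  let ?A = "Poly_Mapping.keys p \<union> Poly_Mapping.keys q"
  have "poly_eval P r = (\<Sum>m\<in>?A. Poly_Mapping.single 0 (Poly_Mapping.lookup r m) * monom_eval P m)"
    if "r \<in> {p, q, p + q}" for r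
    using that keys_add[of p q] by (intro poly_eval_superset) auto
  then show ?thesis by (simp add: lookup_add single_add distrib_right sum.distrib)
qed

lemma poly_eval_sum: "poly_eval P (sum f A) = (\<Sum>i\<in>A. poly_eval P (f i))"
  by (induction A rule: infinite_finite_induct) (auto simp: poly_eval_add)

lemma sum_single_keys: "p = (\<Sum>m\<in>Poly_Mapping.keys p. Poly_Mapping.single m (Poly_Mapping.lookup p m))"
  by (rule poly_mapping_eqI) (auto simp: lookup_sum lookup_single when_def in_keys_iff)

text \<open>Multiplicativity is clear on terms, and both factors are sums of terms.\<close>

lemma poly_eval_mult: "poly_eval P (p * q) = poly_eval P p * poly_eval P q"
proof -
  have 1: "poly_eval P (Poly_Mapping.single m c * Poly_Mapping.single l d)
      = poly_eval P (Poly_Mapping.single m c) * poly_eval P (Poly_Mapping.single l d)" for m c l d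
  proof -
    have c: "Poly_Mapping.single 0 (c * d) = Poly_Mapping.single 0 c * Poly_Mapping.single 0 d"
      by (simp add: mult_single)
    show ?thesis
      unfolding mult_single poly_eval_single monom_eval_add by (simp only: c ac_simps)
  qed
  have 2: "poly_eval P (Poly_Mapping.single m c * q) = poly_eval P (Poly_Mapping.single m c) * poly_eval P q"
    for m c
    by (subst (1 2) sum_single_keys[of q]) (simp only: sum_distrib_left poly_eval_sum 1)
  show ?thesis
    by (subst (1 2) sum_single_keys[of p]) (simp only: sum_distrib_right poly_eval_sum 2)
qed

lemma poly_eval_cong:
  assumes "\<And>m v. m \<in> Poly_Mapping.keys p \<Longrightarrow> v \<in> Poly_Mapping.keys m \<Longrightarrow> P v = Q v"
  shows "poly_eval P p = poly_eval Q p"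
  unfolding poly_eval_def monom_eval_def using assms
  by (intro sum.cong refl arg_cong2[of _ _ _ _ "(*)"] prod.cong) simp

lemma ideal_eval_kernel:
  "ideal {p \<in> carrier (mpoly_ring V). poly_eval P p = 0} (mpoly_ring V)"
proof (rule ideal_mpoly_ringI, safe)
  interpret cring "mpoly_ring V :: ('a, 'b) mpoly ring" by (rule mpoly_ring_cring)
  show "(0 :: ('a, 'b) mpoly) \<in> carrier (mpoly_ring V)" by (simp add: carrier_mpoly_ring)
  fix p q :: "('a, 'b) mpoly"
  assume p: "p \<in> carrier (mpoly_ring V)" and q: "q \<in> carrier (mpoly_ring V)"
  show "p + q \<in> carrier (mpoly_ring V)" using a_closed[OF p q] by (simp add: mpoly_ring_def)
  show "q * p \<in> carrier (mpoly_ring V)" using m_closed[OF q p] by (simp add: mpoly_ring_def)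
qed (simp_all add: poly_eval_add poly_eval_mult)


section \<open>Lexicographically ordered exponent vectors\<close>

lemma exponent_less_iff:
  fixes s t :: "'v::linorder \<Rightarrow>\<^sub>0 int"
  shows "s < t \<longleftrightarrow> (\<exists>v. Poly_Mapping.lookup s v < Poly_Mapping.lookup t v \<and>
    (\<forall>w<v. Poly_Mapping.lookup s w = Poly_Mapping.lookup t w))"
  by transfer (simp add: less_fun_def)

lift_definition to_exponent :: "'v monom \<Rightarrow> ('v \<Rightarrow>\<^sub>0 int)" is "\<lambda>m v. int (m v)"
  by simp

lemma lookup_to_exponent [simp]: "Poly_Mapping.lookup (to_exponent m) v = int (Poly_Mapping.lookup m v)"
  by transfer simp

text \<open>Forget the exponents of all variables that come after \<open>w\<close>, that is, of those that are smaller
  than \<open>w\<close> as monomials.\<close>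

lift_definition cutoff :: "'v::linorder \<Rightarrow> ('v \<Rightarrow>\<^sub>0 int) \<Rightarrow> ('v \<Rightarrow>\<^sub>0 int)" is
  "\<lambda>w g v. if v \<le> w then g v else 0"
  by (rule rev_finite_subset) auto

lemma lookup_cutoff [simp]:
  "Poly_Mapping.lookup (cutoff w g) v = (if v \<le> w then Poly_Mapping.lookup g v else 0)"
  by transfer simp

lemma cutoff_add: "cutoff w (g + h) = cutoff w g + cutoff w h"
  by (rule poly_mapping_eqI) (simp add: lookup_add)

lemma cutoff_zero: "cutoff w 0 = 0"
  by (rule poly_mapping_eqI) simp

lemma to_exponent_add: "to_exponent (s + t) = to_exponent s + to_exponent t"
  by (rule poly_mapping_eqI) (simp add: lookup_add)

lemma to_exponent_zero: "to_exponent 0 = 0"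
  by (rule poly_mapping_eqI) simp

lemma to_exponent_single: "to_exponent (Poly_Mapping.single v 1) = Poly_Mapping.single v 1"
  by (rule poly_mapping_eqI) (simp add: lookup_single when_def)

text \<open>A lexicographic comparison is decided by the first difference, which the cutoff either keeps or
  turns into an equality.\<close>

lemma cutoff_mono:
  assumes "g \<le> h" shows "cutoff w g \<le> cutoff w h"
proof (cases "g = h")
  case False
  with assms have "g < h" by simp
  then obtain x where x: "Poly_Mapping.lookup g x < Poly_Mapping.lookup h x"
    "\<And>y. y < x \<Longrightarrow> Poly_Mapping.lookup g y = Poly_Mapping.lookup h y"
    unfolding exponent_less_iff by blast
  show ?thesis
  proof (cases "x \<le> w")
    case True
    with x have "cutoff w g < cutoff w h" unfolding exponent_less_iff
      by (intro exI[of _ x]) auto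
    then show ?thesis by simp
  next
    case False
    with x(2) have "cutoff w g = cutoff w h" by (intro poly_mapping_eqI) auto
    then show ?thesis by simp
  qed
qed simp

text \<open>In an ordered group only the top exponents of the factors can add up to the sum of two upper
  bounds.\<close>

lemma lookup_mult_top:
  fixes p q :: "'g::linordered_ab_group_add \<Rightarrow>\<^sub>0 'a::comm_ring_1"
  assumes p: "\<And>a. a \<in> Poly_Mapping.keys p \<Longrightarrow> a \<le> g" and q: "\<And>b. b \<in> Poly_Mapping.keys q \<Longrightarrow> b \<le> h"
  shows "Poly_Mapping.lookup (p * q) (g + h) = Poly_Mapping.lookup p g * Poly_Mapping.lookup q h"
proof -
  define p' where "p' = p - Poly_Mapping.single g (Poly_Mapping.lookup p g)"
  define q' where "q' = q - Poly_Mapping.single h (Poly_Mapping.lookup q h)"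
  have p': "a < g" if "a \<in> Poly_Mapping.keys p'" for a
  proof -
    have "Poly_Mapping.lookup p' a \<noteq> 0" using that by (simp add: in_keys_iff)
    then have "a \<noteq> g" "a \<in> Poly_Mapping.keys p"
      by (auto simp: p'_def lookup_minus lookup_single when_def in_keys_iff split: if_splits)
    with p[of a] show ?thesis by simp
  qed
  have q': "b < h" if "b \<in> Poly_Mapping.keys q'" for b
  proof -
    have "Poly_Mapping.lookup q' b \<noteq> 0" using that by (simp add: in_keys_iff)
    then have "b \<noteq> h" "b \<in> Poly_Mapping.keys q"
      by (auto simp: q'_def lookup_minus lookup_single when_def in_keys_iff split: if_splits)
    with q[of b] show ?thesis by simp
  qed
  have 1: "Poly_Mapping.lookup (p' * q) (g + h) = 0"
  proof -
    have "g + h \<notin> Poly_Mapping.keys (p' * q)"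
    proof
      assume "g + h \<in> Poly_Mapping.keys (p' * q)"
      then obtain a b where "g + h = a + b" "a \<in> Poly_Mapping.keys p'" "b \<in> Poly_Mapping.keys q"
        using keys_mult[of p' q] by blast
      with add_less_le_mono[OF p'[of a] q[of b]] show False by simp
    qed
    then show ?thesis by (simp add: in_keys_iff)
  qed
  have 2: "Poly_Mapping.lookup (Poly_Mapping.single g c * q') (g + h) = 0" for c
  proof -
    have "g + h \<notin> Poly_Mapping.keys (Poly_Mapping.single g c * q')"
    proof
      assume "g + h \<in> Poly_Mapping.keys (Poly_Mapping.single g c * q')"
      then obtain a b where "g + h = a + b" "a \<in> Poly_Mapping.keys (Poly_Mapping.single g c)"
          "b \<in> Poly_Mapping.keys q'"
        using keys_mult[of "Poly_Mapping.single g c" q'] by blast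
      with q'[of b] show False by (auto split: if_splits)
    qed
    then show ?thesis by (simp add: in_keys_iff)
  qed
  have "p * q = p' * q + Poly_Mapping.single g (Poly_Mapping.lookup p g) * q'
      + Poly_Mapping.single (g + h) (Poly_Mapping.lookup p g * Poly_Mapping.lookup q h)"
    unfolding mult_single[symmetric] by (simp add: p'_def q'_def algebra_simps)
  then show ?thesis by (simp add: lookup_add 1 2)
qed

lemma cutoff_keys_monom_eval_le:
  fixes P :: "'v::linorder \<Rightarrow> ('v \<Rightarrow>\<^sub>0 int) \<Rightarrow>\<^sub>0 'a::comm_ring_1"
  assumes "\<And>v \<kappa>. v \<in> Poly_Mapping.keys m \<Longrightarrow> \<kappa> \<in> Poly_Mapping.keys (P v) \<Longrightarrow>
      cutoff w \<kappa> \<le> cutoff w (Poly_Mapping.single v 1)"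
    and "\<kappa> \<in> Poly_Mapping.keys (monom_eval P m)"
  shows "cutoff w \<kappa> \<le> cutoff w (to_exponent m)"
  using assms
proof (induction m arbitrary: \<kappa> rule: monom_induct)
  case zero
  then show ?case by (simp add: to_exponent_zero split: if_splits)
next
  case (add m v)
  obtain a b where ab: "\<kappa> = a + b" "a \<in> Poly_Mapping.keys (monom_eval P m)" "b \<in> Poly_Mapping.keys (P v)"
    using add(3) keys_mult[of "monom_eval P m" "P v"] unfolding monom_eval_add monom_eval_single
    by blast
  have "cutoff w a \<le> cutoff w (to_exponent m)"
    using ab(2) add(2) by (intro add(1)) (auto simp: keys_add_monom)
  moreover have "cutoff w b \<le> cutoff w (Poly_Mapping.single v 1)"
    using ab(3) add(2) by (simp add: keys_add_monom)
  ultimately show ?case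
    unfolding ab(1) to_exponent_add cutoff_add to_exponent_single by (rule add_mono)
qed

lemma monom_eval_top:
  fixes P :: "'v::linorder \<Rightarrow> ('v \<Rightarrow>\<^sub>0 int) \<Rightarrow>\<^sub>0 'a::idom"
  assumes "\<And>v \<kappa>. v \<in> Poly_Mapping.keys m \<Longrightarrow> \<kappa> \<in> Poly_Mapping.keys (P v) \<Longrightarrow> \<kappa> \<le> Poly_Mapping.single v 1"
    and "\<And>v. v \<in> Poly_Mapping.keys m \<Longrightarrow> Poly_Mapping.lookup (P v) (Poly_Mapping.single v 1) \<noteq> 0"
  shows "(\<forall>\<kappa>\<in>Poly_Mapping.keys (monom_eval P m). \<kappa> \<le> to_exponent m) \<and>
     Poly_Mapping.lookup (monom_eval P m) (to_exponent m) \<noteq> 0"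
  using assms
proof (induction m rule: monom_induct)
  case zero
  then show ?case by (simp add: to_exponent_zero)
next
  case (add m v)
  have IH: "\<forall>\<kappa>\<in>Poly_Mapping.keys (monom_eval P m). \<kappa> \<le> to_exponent m"
     "Poly_Mapping.lookup (monom_eval P m) (to_exponent m) \<noteq> 0"
    using add by (auto simp: keys_add_monom)
  have v: "v \<in> Poly_Mapping.keys (m + Poly_Mapping.single v 1)" by (simp add: keys_add_monom)
  have "\<kappa> \<le> to_exponent m + Poly_Mapping.single v 1"
    if \<kappa>: "\<kappa> \<in> Poly_Mapping.keys (monom_eval P m * P v)" for \<kappa>
  proof -
    obtain a b where "\<kappa> = a + b" "a \<in> Poly_Mapping.keys (monom_eval P m)" "b \<in> Poly_Mapping.keys (P v)"
      using \<kappa> keys_mult[of "monom_eval P m" "P v"] by blast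
    then show ?thesis using add_mono[of a "to_exponent m" b] IH(1) add(2)[OF v] by blast
  qed
  moreover have "Poly_Mapping.lookup (monom_eval P m * P v) (to_exponent m + Poly_Mapping.single v 1) \<noteq> 0"
    using lookup_mult_top[of "monom_eval P m" "to_exponent m" "P v" "Poly_Mapping.single v 1"]
      IH add(2,3)[OF v] by simp
  ultimately show ?case unfolding monom_eval_add monom_eval_single to_exponent_add to_exponent_single
    by blast
qed

text \<open>A criterion for not vanishing at a point. At the variables of the leading monomial \<open>u\<close> the point
  has a coordinate with leading exponent that of the variable itself, so \<open>u\<close> contributes a nonzero
  coefficient at exponent \<open>u\<close>. The other variables \<open>v\<close> may be sent to complicated Laurent
  polynomials, as long as these involve variables larger than \<open>v\<close> only in a way that makes them
  small. Another monomial \<open>m\<close> of \<open>f\<close> is smaller than \<open>u\<close> because of a first variable \<open>w\<close> with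
  exponent too small; the variables of \<open>m\<close> outside \<open>u\<close> all come after \<open>w\<close>, so their values do not
  raise the exponents up to \<open>w\<close>, and \<open>m\<close> cannot reach exponent \<open>u\<close>. Hence nothing cancels the
  contribution of \<open>u\<close>.\<close>

lemma poly_eval_nonzero:
  fixes f :: "('v::linorder, 'a::field) mpoly"
  assumes f: "f \<in> carrier (mpoly_ring V)" "f \<noteq> 0"
    and top: "\<And>v \<kappa>. v \<in> Poly_Mapping.keys (lead_monom f) \<Longrightarrow> \<kappa> \<in> Poly_Mapping.keys (P v) \<Longrightarrow>
        \<kappa> \<le> Poly_Mapping.single v 1"
      "\<And>v. v \<in> Poly_Mapping.keys (lead_monom f) \<Longrightarrow>
        Poly_Mapping.lookup (P v) (Poly_Mapping.single v 1) \<noteq> 0"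
    and small: "\<And>v w \<kappa>. v \<in> V \<Longrightarrow> v \<notin> Poly_Mapping.keys (lead_monom f) \<Longrightarrow> w < v \<Longrightarrow>
        \<kappa> \<in> Poly_Mapping.keys (P v) \<Longrightarrow> cutoff w \<kappa> \<le> 0"
  shows "poly_eval P f \<noteq> 0"
proof -
  define u where "u = lead_monom f"
  have u: "u \<in> Poly_Mapping.keys f" using f(2) unfolding u_def lead_monom_def by (intro Max_in) auto
  have u_top: "Poly_Mapping.lookup (monom_eval P u) (to_exponent u) \<noteq> 0"
    using monom_eval_top[of u P] top unfolding u_def by blast
  have other: "Poly_Mapping.lookup (monom_eval P m) (to_exponent u) = 0"
    if m: "m \<in> Poly_Mapping.keys f" "m \<noteq> u" for m
  proof (rule ccontr)
    assume "Poly_Mapping.lookup (monom_eval P m) (to_exponent u) \<noteq> 0"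
    then have key: "to_exponent u \<in> Poly_Mapping.keys (monom_eval P m)" by (simp add: in_keys_iff)
    \<comment> \<open>\<open>w\<close> is the variable at which the lexicographic comparison of \<open>m\<close> and \<open>u\<close> is decided.\<close>
    have "m \<le> u" using m(1) unfolding u_def lead_monom_def by simp
    with m(2) have "m < u" by simp
    then obtain w where w: "Poly_Mapping.lookup m w < Poly_Mapping.lookup u w"
      "\<And>x. x < w \<Longrightarrow> Poly_Mapping.lookup m x = Poly_Mapping.lookup u x"
      unfolding monom_less_iff by blast
    have "cutoff w \<kappa> \<le> cutoff w (Poly_Mapping.single v 1)"
      if v: "v \<in> Poly_Mapping.keys m" and \<kappa>: "\<kappa> \<in> Poly_Mapping.keys (P v)" for v \<kappa>
    proof (cases "v \<in> Poly_Mapping.keys u")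
      case True
      then show ?thesis using top(1) \<kappa> unfolding u_def by (intro cutoff_mono) blast
    next
      case False
      then have "Poly_Mapping.lookup u v = 0" "Poly_Mapping.lookup m v > 0"
        using v by (auto simp: in_keys_iff)
      then have "w < v" using w by (metis less_irrefl linorder_neqE not_less_zero)
      moreover have "v \<in> V" using v m(1) f(1) by (auto simp: carrier_mpoly_ring)
      ultimately have "cutoff w \<kappa> \<le> 0" using small \<kappa> False unfolding u_def by blast
      also have "0 = cutoff w (Poly_Mapping.single v 1)"
        using \<open>w < v\<close> by (intro poly_mapping_eqI) (auto simp: lookup_single when_def)
      finally show ?thesis .
    qed
    then have "cutoff w (to_exponent u) \<le> cutoff w (to_exponent m)"
      using key by (rule cutoff_keys_monom_eval_le)
    moreover have "cutoff w (to_exponent m) < cutoff w (to_exponent u)"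
      unfolding exponent_less_iff using w by (intro exI[of _ w]) auto
    ultimately show False by simp
  qed
  have "Poly_Mapping.lookup (poly_eval P f) (to_exponent u)
      = (\<Sum>m\<in>Poly_Mapping.keys f. Poly_Mapping.lookup f m * Poly_Mapping.lookup (monom_eval P m) (to_exponent u))"
    unfolding poly_eval_def lookup_sum mult_map_scale_conv_mult[symmetric]
    by (intro sum.cong refl) (simp add: Poly_Mapping.map.rep_eq when_def)
  also have "\<dots> = (\<Sum>m\<in>{u}. Poly_Mapping.lookup f m * Poly_Mapping.lookup (monom_eval P m) (to_exponent u))"
    using u other by (intro sum.mono_neutral_right) auto
  also have "\<dots> \<noteq> 0" using u u_top by (simp add: in_keys_iff)
  finally show ?thesis by auto
qed


section \<open>The chain of ideals\<close>

lemma keys_xmonom: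
  assumes as: "as \<in> C n k" and km: "k \<le> m" "m \<le> n" and p: "p permutes {0..<k}" and k: "1 \<le> k"
  shows "Poly_Mapping.keys (xmonom k as m p) \<subseteq> vars n"
proof
  fix v assume v: "v \<in> Poly_Mapping.keys (xmonom k as m p)"
  show "v \<in> vars n"
  proof (cases v)
    case (Y j)
    with v have "j = m" by (simp add: in_keys_iff lookup_xmonom_Y split: if_splits)
    then show ?thesis using Y k km by (simp add: vars_def)
  next
    case (X i j)
    with v obtain d where d: "d < k" "as ! d = i" "mcol k m (p d) = j"
      using lookup_xmonom_X_nonzero in_keys_iff by metis
    have "p d < k" using permutes_in_image[OF p, of d] d by simp
    with d(3) k km have "1 \<le> j" "j \<le> n" by (auto simp: mcol_def split: if_splits)
    then show ?thesis using in_C_nth[OF as d(1)] d(2) X by (simp add: vars_def)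
  qed
qed

lemma Xtilde_carrier:
  assumes "as \<in> C n k" "1 \<le> k" "k \<le> n"
  shows "(Xtilde n k as :: (var, 'a::comm_ring_1) mpoly) \<in> carrier (Rhat n)"
  unfolding carrier_mpoly_ring
proof
  fix m assume "m \<in> Poly_Mapping.keys (Xtilde n k as :: (var, 'a) mpoly)"
  then show "Poly_Mapping.keys m \<subseteq> vars n"
    using keys_Xtilde[OF assms] keys_xmonom[OF assms(1)] assms(2) by metis
qed

lemma Stilde_carrier:
  assumes "1 \<le> k" "k \<le> n"
  shows "(Stilde n k :: (var, 'a::comm_ring_1) mpoly set) \<subseteq> carrier (Rhat n)"
  using Xtilde_carrier assms by (auto simp: Stilde_def)

lemma Itilde_ideal:
  assumes "1 \<le> k" "k \<le> n"
  shows "ideal (Itilde n k :: (var, 'a::comm_ring_1) mpoly set) (Rhat n)"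
    and "(Stilde n k :: (var, 'a) mpoly set) \<subseteq> Itilde n k"
  unfolding Itilde_def using Idl_mpoly_ring[OF Stilde_carrier[OF assms]] by auto

definition delete_nth :: "nat \<Rightarrow> 'b list \<Rightarrow> 'b list" where
  "delete_nth i xs = take i xs @ drop (Suc i) xs"

lemma delete_nth_nth:
  assumes "i < length xs" "j < length xs - 1"
  shows "delete_nth i xs ! j = xs ! (if j < i then j else Suc j)"
  using assms by (auto simp: delete_nth_def nth_append min_def)

lemma delete_nth_C:
  assumes "as \<in> C n (Suc k)" "i < Suc k"
  shows "delete_nth i as \<in> C n k"
proof -
  have as: "length as = Suc k" "sorted_wrt (<) as" "set as \<subseteq> {1..n+1}" using assms(1) by (auto simp: C_def)
  have len: "length (delete_nth i as) = k" using as(1) assms(2) by (simp add: delete_nth_def)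
  have "set (delete_nth i as) \<subseteq> set as"
    unfolding delete_nth_def by (auto dest: in_set_takeD in_set_dropD)
  moreover have "sorted_wrt (<) (delete_nth i as)"
    unfolding sorted_wrt_iff_nth_less len
    using as assms(2) by (auto simp: delete_nth_nth sorted_wrt_iff_nth_less)
  ultimately show ?thesis using len as(3) by (auto simp: C_def)
qed

text \<open>Expansion along column \<open>k\<close>, which has index \<open>k - 1\<close>. Deleting it turns the columns
  \<open>1, \<dots>, k, m\<close> into \<open>1, \<dots>, k - 1, m\<close>, the columns of the polynomials one level below.\<close>

lemma minor_laplace:
  assumes as: "as \<in> C n (Suc k)" and k: "1 \<le> k" "k \<le> n"
  shows "(minor n as ([1..<Suc k] @ [m]) :: (var, 'a::comm_ring_1) mpoly) =
    (\<Sum>i<Suc k. indet (X (as ! i) k) * (-1) ^ (i + (k - 1)) * minor n (delete_nth i as) ([1..<k] @ [m]))"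
proof -
  let ?bs = "[1..<Suc k] @ [m]"
  have la: "length as = Suc k" using as by (simp add: C_def)
  have lb: "length ?bs = Suc k" using k by simp
  let ?A = "mat (Suc k) (Suc k) (\<lambda>(i, j). Xhat n $$ (as ! i - 1, ?bs ! j - 1)) :: (var, 'a) mpoly mat"
  have A: "?A \<in> carrier_mat (Suc k) (Suc k)" by simp
  have entry: "?A $$ (i, k - 1) = indet (X (as ! i) k)" if i: "i < Suc k" for i
  proof -
    have b: "?bs ! (k - 1) = k" using k by (subst nth_mcol) (auto simp: mcol_def)
    note r = in_C_nth[OF as i]
    have "as ! i - 1 < n + 1" using r by linarith
    then have "(Xhat n $$ (as ! i - 1, k - 1) :: (var, 'a) mpoly) = indet (X (as ! i - 1 + 1) (k - 1 + 1))"
      using k by (simp add: Xhat_def)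
    also have "as ! i - 1 + 1 = as ! i" using r by linarith
    also have "k - 1 + 1 = k" using k by linarith
    finally show ?thesis using i b k by simp
  qed
  have del: "mat_delete ?A i (k - 1) =
      mat k k (\<lambda>(i', j'). Xhat n $$ (delete_nth i as ! i' - 1, ([1..<k] @ [m]) ! j' - 1))"
    if i: "i < Suc k" for i
  proof (rule eq_matI)
    fix i' j' assume "i' < dim_row (mat k k (\<lambda>(i', j'). Xhat n $$ (delete_nth i as ! i' - 1, ([1..<k] @ [m]) ! j' - 1) :: (var, 'a) mpoly))"
      and "j' < dim_col (mat k k (\<lambda>(i', j'). Xhat n $$ (delete_nth i as ! i' - 1, ([1..<k] @ [m]) ! j' - 1) :: (var, 'a) mpoly))"
    then have ij: "i' < k" "j' < k" by simp_all
    have col: "?bs ! (if j' < k - 1 then j' else Suc j') = ([1..<k] @ [m]) ! j'"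
    proof -
      have "(if j' < k - 1 then j' else Suc j') < Suc k" using ij by simp
      from nth_mcol[OF this] show ?thesis unfolding nth_mcol[OF ij(2)]
        using ij k by (auto simp: mcol_def)
    qed
    have row: "as ! (if i' < i then i' else Suc i') = delete_nth i as ! i'"
      using i ij la by (simp add: delete_nth_nth)
    have "mat_delete ?A i (k - 1) $$ (i', j')
        = ?A $$ (if i' < i then i' else Suc i', if j' < k - 1 then j' else Suc j')"
      using ij unfolding mat_delete_def by simp
    also have "\<dots> = Xhat n $$ (as ! (if i' < i then i' else Suc i') - 1, ?bs ! (if j' < k - 1 then j' else Suc j') - 1)"
      using ij by (subst index_mat) simp_all
    finally show "mat_delete ?A i (k - 1) $$ (i', j') =
       mat k k (\<lambda>(i', j'). Xhat n $$ (delete_nth i as ! i' - 1, ([1..<k] @ [m]) ! j' - 1)) $$ (i', j')"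
      unfolding col row using ij by simp
  qed (simp_all add: mat_delete_def)
  have "minor n as ?bs = (\<Sum>i<Suc k. ?A $$ (i, k - 1) * cofactor ?A i (k - 1))"
    unfolding minor_def la lb by (rule laplace_expansion_column[OF A]) simp
  also have "\<dots> = (\<Sum>i<Suc k. indet (X (as ! i) k) * (-1) ^ (i + (k - 1)) * minor n (delete_nth i as) ([1..<k] @ [m]))"
  proof (intro sum.cong refl)
    fix i assume "i \<in> {..<Suc k}"
    then have i: "i < Suc k" by simp
    have l1: "length (delete_nth i as) = k" using delete_nth_C[OF as i] by (simp add: C_def)
    have l2: "length ([1..<k] @ [m]) = k" using k by simp
    show "?A $$ (i, k - 1) * cofactor ?A i (k - 1)
        = indet (X (as ! i) k) * (-1) ^ (i + (k - 1)) * minor n (delete_nth i as) ([1..<k] @ [m])"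
      unfolding cofactor_def entry[OF i] del[OF i] minor_def l1 l2 by (simp only: mult.assoc)
  qed
  finally show ?thesis .
qed

lemma minor_repeated_column:
  assumes as: "as \<in> C n (Suc k)" and k: "1 \<le> k"
  shows "(minor n as ([1..<Suc k] @ [k]) :: (var, 'a::comm_ring_1) mpoly) = 0"
proof -
  let ?bs = "[1..<Suc k] @ [k]"
  have la: "length as = Suc k" using as by (simp add: C_def)
  have lb: "length ?bs = Suc k" using k by simp
  have b: "?bs ! (k - 1) = k" "?bs ! k = k"
    using k by (subst nth_mcol; simp add: mcol_def)+
  show ?thesis unfolding minor_def la lb
  proof (rule det_identical_columns)
    show "k - 1 \<noteq> k" "k - 1 < Suc k" "k < Suc k" using k by auto
    show "col (mat (Suc k) (Suc k) (\<lambda>(i, j). Xhat n $$ (as ! i - 1, ?bs ! j - 1))) (k - 1) =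
       col (mat (Suc k) (Suc k) (\<lambda>(i, j). Xhat n $$ (as ! i - 1, ?bs ! j - 1)) :: (var, 'a) mpoly mat) k"
      using k b by (intro eq_vecI) (simp_all del: upt_Suc)
  qed simp
qed

text \<open>The polynomial \<open>Xtilde n k as\<close> is the determinant with columns \<open>X\<^sup>1, \<dots>, X\<^bsup>k-1\<^esup>, XY\<close>
  (in the rows \<open>as\<close>), since the summands \<open>X\<^sup>m y\<^sub>m\<close> with \<open>m < k\<close> repeat an earlier column. So a
  Laplace expansion along column \<open>k\<close> expresses each polynomial of level \<open>k + 1\<close> by polynomials of
  level \<open>k\<close>.\<close>

lemma Xtilde_Suc:
  assumes as: "as \<in> C n (Suc k)" and k: "1 \<le> k" "Suc k \<le> n"
  shows "(Xtilde n (Suc k) as :: (var, 'a::comm_ring_1) mpoly) =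
    (\<Sum>i<Suc k. indet (X (as ! i) k) * (-1) ^ (i + (k - 1)) * Xtilde n k (delete_nth i as))"
proof -
  let ?c = "\<lambda>i. indet (X (as ! i) k) * (-1) ^ (i + (k - 1)) :: (var, 'a) mpoly"
  \<comment> \<open>The summand \<open>m = k\<close> may be added because its minor repeats column \<open>k\<close>.\<close>
  have "(Xtilde n (Suc k) as :: (var, 'a) mpoly) = (\<Sum>m=k..n. minor n as ([1..<Suc k] @ [m]) * indet (Y m))"
    unfolding Xtilde_def using k
    by (subst (2) sum.atLeast_Suc_atMost) (simp_all only: minor_repeated_column[OF as k(1)] mult_zero_left add_0 Suc_leD)
  also have "\<dots> = (\<Sum>m=k..n. \<Sum>i<Suc k. ?c i * (minor n (delete_nth i as) ([1..<k] @ [m]) * indet (Y m)))"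
    using k by (simp only: minor_laplace[OF as] Suc_leD sum_distrib_right mult.assoc)
  also have "\<dots> = (\<Sum>i<Suc k. ?c i * Xtilde n k (delete_nth i as))"
    unfolding Xtilde_def sum_distrib_left by (rule sum.swap)
  finally show ?thesis .
qed

lemma indet_carrier: "v \<in> V \<Longrightarrow> indet v \<in> carrier (mpoly_ring V)"
  by (auto simp: indet_def carrier_mpoly_ring)

lemma Itilde_Suc_subset:
  assumes k: "1 \<le> k" "Suc k \<le> n"
  shows "(Itilde n (Suc k) :: (var, 'a::comm_ring_1) mpoly set) \<subseteq> Itilde n k"
proof -
  interpret cring "Rhat n :: (var, 'a) mpoly ring" by (rule mpoly_ring_cring)
  have k': "k \<le> n" using k by simp
  note I = Itilde_ideal[OF k(1) k', where 'a = 'a]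
  have "Xtilde n (Suc k) as \<in> (Itilde n k :: (var, 'a) mpoly set)" if as: "as \<in> C n (Suc k)" for as
    unfolding Xtilde_Suc[OF as k]
  proof (rule ideal_sum[OF I(1)], rule ideal_mpoly_ringD(4)[OF I(1)])
    fix i assume "i \<in> {..<Suc k}"
    then have i: "i < Suc k" by simp
    show "Xtilde n k (delete_nth i as) \<in> (Itilde n k :: (var, 'a) mpoly set)"
      using delete_nth_C[OF as i] I(2) by (auto simp: Stilde_def)
    have x: "(indet (X (as ! i) k) :: (var, 'a) mpoly) \<in> carrier (Rhat n)"
      using in_C_nth[OF as i] k by (intro indet_carrier) (auto simp: vars_def)
    have "((-1) ^ (i + (k - 1)) :: (var, 'a) mpoly) \<in> carrier (Rhat n)"
      by (cases "even (i + (k - 1))") (simp_all add: carrier_mpoly_ring)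
    from m_closed[OF x this]
    show "(indet (X (as ! i) k) * (-1) ^ (i + (k - 1)) :: (var, 'a) mpoly) \<in> carrier (Rhat n)"
      by (simp add: mpoly_ring_def)
  qed
  then show ?thesis unfolding Itilde_def[of n "Suc k"]
    by (intro Idl_mpoly_ring_minimal[OF I(1)]) (auto simp: Stilde_def)
qed

lemma Itilde_antimono:
  assumes "k \<le> l" "1 \<le> k" "l \<le> n"
  shows "(Itilde n l :: (var, 'a::comm_ring_1) mpoly set) \<subseteq> Itilde n k"
  using assms
proof (induction l rule: dec_induct)
  case (step l)
  then show ?case using Itilde_Suc_subset[of l n, where 'a = 'a] by auto
qed simp

lemma Gset_subset_Itilde:
  assumes "1 \<le> k" "k \<le> n"
  shows "(Gset n k :: (var, 'a::comm_ring_1) mpoly set) \<subseteq> Itilde n k"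
proof -
  have "(Stilde n i :: (var, 'a) mpoly set) \<subseteq> Itilde n k" if "i \<in> {k..n}" for i
    using that assms Itilde_ideal(2)[of i n, where 'a = 'a] Itilde_antimono[of k i n, where 'a = 'a] by auto
  then show ?thesis unfolding Gset_def by blast
qed

lemma C_one: "C n 1 = (\<lambda>i. [i]) ` {1..n+1}"
  by (auto simp: C_def length_Suc_conv)

lemma Xtilde_one:
  assumes "1 \<le> i" "i \<le> n + 1"
  shows "(Xtilde n 1 [i] :: (var, 'a::comm_ring_1) mpoly) = (\<Sum>m=1..n. indet (X i m) * indet (Y m))"
  unfolding Xtilde_def
proof (intro sum.cong refl)
  fix m assume m: "m \<in> {1..n}"
  have "(minor n [i] ([1..<1] @ [m]) :: (var, 'a) mpoly) = Xhat n $$ (i - 1, m - 1)"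
    unfolding minor_def by (subst det_single) simp_all
  also have "\<dots> = indet (X (i - 1 + 1) (m - 1 + 1))"
  proof -
    have "i - 1 < n + 1" "m - 1 < n" using m assms by auto
    then show ?thesis unfolding Xhat_def by (subst index_mat) auto
  qed
  also have "\<dots> = indet (X i m)" using m assms by simp
  finally show "minor n [i] ([1..<1] @ [m]) * indet (Y m) = (indet (X i m) * indet (Y m) :: (var, 'a) mpoly)"
    by simp
qed

lemma Itilde_one: "(Itilde n 1 :: (var, 'a::comm_ring_1) mpoly set) = I1_XY n"
proof -
  have entry: "(Xhat n * Ymat n) $$ (i, 0) = (Xtilde n 1 [Suc i] :: (var, 'a) mpoly)" if "i < n + 1" for i
  proof -
    have "(Xhat n * Ymat n) $$ (i, 0) = (\<Sum>j<n. indet (X (Suc i) (Suc j)) * (indet (Y (Suc j)) :: (var, 'a) mpoly))"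
      using that by (simp add: Xhat_def Ymat_def scalar_prod_def atLeast0LessThan)
    also have "\<dots> = (\<Sum>m=1..n. indet (X (Suc i) m) * indet (Y m))"
      by (rule sum.reindex_bij_witness[of _ "\<lambda>m. m - 1" Suc]) auto
    also have "\<dots> = Xtilde n 1 [Suc i]" using that by (intro Xtilde_one[symmetric]) auto
    finally show ?thesis .
  qed
  have dim: "(Xhat n * Ymat n :: (var, 'a) mpoly mat) \<in> carrier_mat (n + 1) 1"
    by (rule mult_carrier_mat[of _ _ n]) (simp_all add: Xhat_def Ymat_def)
  have "(elements_mat (Xhat n * Ymat n) :: (var, 'a) mpoly set) = (\<lambda>i. (Xhat n * Ymat n) $$ (i, 0)) ` {..<n+1}"
  proof (intro equalityI subsetI)
    fix a :: "(var, 'a) mpoly" assume "a \<in> elements_mat (Xhat n * Ymat n)"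
    from elements_matD[OF this] show "a \<in> (\<lambda>i. (Xhat n * Ymat n) $$ (i, 0)) ` {..<n+1}"
      using carrier_matD[OF dim] by auto
  next
    fix a :: "(var, 'a) mpoly" assume "a \<in> (\<lambda>i. (Xhat n * Ymat n) $$ (i, 0)) ` {..<n+1}"
    then show "a \<in> elements_mat (Xhat n * Ymat n)" using elements_matI[OF dim] by auto
  qed
  also have "\<dots> = (\<lambda>i. Xtilde n 1 [Suc i]) ` {..<n+1}" using entry by (intro image_cong) auto
  also have "\<dots> = (\<lambda>i. Xtilde n 1 [i]) ` (Suc ` {..<n+1})" by (simp only: image_image)
  also have "Suc ` {..<n+1} = {1..n+1}" by (simp add: image_Suc_lessThan)
  also have "(\<lambda>i. Xtilde n 1 [i]) ` {1..n+1} = (Stilde n 1 :: (var, 'a) mpoly set)"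
    unfolding Stilde_def C_one image_image ..
  finally show ?thesis unfolding Itilde_def I1_XY_def by simp
qed


section \<open>A Laurent point on the variety\<close>

abbreviation unit_exp :: "'v \<Rightarrow> 'v \<Rightarrow>\<^sub>0 int" where
  "unit_exp v \<equiv> Poly_Mapping.single v 1"

text \<open>Here \<open>S i j\<close> stands for \<open>x\<^sub>i\<^sub>j\<close> dividing a given monomial. The rows are chosen greedily: the
  first one is the least row with \<open>S i 1\<close>, each later one the least row further down with \<open>S\<close> in the
  next column. Row \<open>0\<close> only starts the recursion.\<close>

primrec greedy_row :: "(nat \<Rightarrow> nat \<Rightarrow> bool) \<Rightarrow> nat \<Rightarrow> nat" where
  "greedy_row S 0 = 0"
| "greedy_row S (Suc d) = (LEAST i. greedy_row S d < i \<and> S i (Suc d))"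

text \<open>The greedy choice stops after \<open>t\<close> steps. To each row \<open>i\<close> belongs a pivot column \<open>c i\<close>, the column
  in which the choice is searching when it inspects row \<open>i\<close>. By minimality of the choice, \<open>S\<close> holds at
  a pivot position only if the row is one of the chosen rows.\<close>

lemma greedy_chain:
  fixes S :: "nat \<Rightarrow> nat \<Rightarrow> bool"
  assumes bound: "\<And>i j. S i j \<Longrightarrow> j \<le> b"
  obtains t r c where "\<And>d. d < t \<Longrightarrow> r d < r (Suc d)"
    and "\<And>d. d < t \<Longrightarrow> S (r (Suc d)) (Suc d)"
    and "\<And>i. 1 \<le> c i" "\<And>i. c i \<le> Suc t"
    and "\<And>i. 1 \<le> i \<Longrightarrow> r (c i - 1) < i"
    and "\<And>i. c i \<le> t \<Longrightarrow> i \<le> r (c i)"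
    and "\<And>i. 1 \<le> i \<Longrightarrow> S i (c i) \<Longrightarrow> c i \<le> t \<and> i = r (c i)"
proof -
  define r where "r = greedy_row S"
  define t where "t = (LEAST t. \<forall>i>r t. \<not> S i (Suc t))"
  define c where "c = (\<lambda>i. LEAST c. 1 \<le> c \<and> (c = Suc t \<or> i \<le> r c))"
  have "\<forall>i>r b. \<not> S i (Suc b)" using bound by fastforce
  then have t_end: "\<forall>i>r t. \<not> S i (Suc t)" unfolding t_def by (rule LeastI)
  have step: "r d < r (Suc d) \<and> S (r (Suc d)) (Suc d)" if "d < t" for d
  proof -
    have "\<exists>i. r d < i \<and> S i (Suc d)" using not_less_Least[of d] that unfolding t_def by blast
    from LeastI_ex[OF this] show ?thesis unfolding r_def by simp
  qed
  have r_min: "\<not> S i (Suc d)" if "r d < i" "i < r (Suc d)" for d i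
    using that not_less_Least[of i "\<lambda>i. r d < i \<and> S i (Suc d)"] unfolding r_def by auto
  have c: "1 \<le> c i \<and> (c i = Suc t \<or> i \<le> r (c i))" for i
    unfolding c_def by (rule LeastI[of _ "Suc t"]) simp
  have c_le: "c i \<le> Suc t" for i unfolding c_def by (rule Least_le) simp
  have c_gt: "r (c i - 1) < i" if "1 \<le> i" for i
  proof (cases "c i = 1")
    case True
    then show ?thesis using that by (simp add: r_def)
  next
    case False
    then have "c i - 1 < c i" "1 \<le> c i - 1" using c[of i] by auto
    then show ?thesis using not_less_Least[of "c i - 1" "\<lambda>c. 1 \<le> c \<and> (c = Suc t \<or> i \<le> r c)"]
      unfolding c_def by auto
  qed
  have diag: "c i \<le> t \<and> i = r (c i)" if i: "1 \<le> i" "S i (c i)" for i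
  proof -
    have s: "Suc (c i - 1) = c i" using c[of i] by simp
    have "c i \<noteq> Suc t" using t_end i(2) c_gt[OF i(1)] s by force
    then have "c i \<le> t" "i \<le> r (c i)" using c_le[of i] c[of i] by auto
    moreover have "\<not> i < r (c i)" using r_min[of "c i - 1" i] c_gt[OF i(1)] i(2) s by auto
    ultimately show ?thesis by simp
  qed
  show thesis
  proof (rule that[of t r c])
    show "i \<le> r (c i)" if "c i \<le> t" for i using c[of i] that by auto
  qed (use step c c_le c_gt diag in auto)
qed

lemma chain_strict:
  fixes r :: "nat \<Rightarrow> nat"
  assumes "\<And>d. d < t \<Longrightarrow> r d < r (Suc d)" and "d < e" "e \<le> t"
  shows "r d < r e"
  using assms(2,3)
proof (induction e)
  case (Suc e)
  then show ?case using assms(1)[of e] by (cases "d = e") auto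
qed simp

text \<open>The combinatorial data from which the point is built: the chosen rows \<open>r 1 < \<dots> < r t\<close> and the
  pivot columns \<open>c i\<close>, that is, \<open>r (c i - 1) < i \<le> r (c i)\<close>, where the upper bound is dropped for
  \<open>c i = t + 1\<close>.\<close>

locale staircase =
  fixes n t :: nat and r c :: "nat \<Rightarrow> nat"
  assumes t_less: "t < n"
    and r_less: "\<And>d. d < t \<Longrightarrow> r d < r (Suc d)"
    and c_ge: "\<And>i. 1 \<le> c i" and c_le: "\<And>i. c i \<le> Suc t"
    and c_gt: "\<And>i. 1 \<le> i \<Longrightarrow> r (c i - 1) < i"
    and c_row: "\<And>i. c i \<le> t \<Longrightarrow> i \<le> r (c i)"
begin

text \<open>The exponents \<open>\<beta>\<^sub>j\<close> of the \<open>y\<close>-coordinates. For \<open>j \<le> t\<close> they are chosen such that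
  \<open>x\<^sub>i\<^sub>j y\<^sub>j\<close> and \<open>x\<^sub>i\<^sub>,\<^sub>j\<^sub>+\<^sub>1 y\<^sub>j\<^sub>+\<^sub>1\<close> have the same exponent in row \<open>i = r j\<close>. These are the
  leading exponents that Cramer's rule gives when the chosen rows of \<open>XY = 0\<close> are solved for
  \<open>y\<^sub>1, \<dots>, y\<^sub>t\<close>.\<close>

definition y_exp :: "nat \<Rightarrow> var \<Rightarrow>\<^sub>0 int" where
  "y_exp j = (if j \<le> t
     then unit_exp (Y (Suc t)) + (\<Sum>d\<in>{j..<Suc t}. unit_exp (X (r d) (Suc d)) - unit_exp (X (r d) d))
     else unit_exp (Y j))"

text \<open>The exponent of \<open>x\<^sub>i\<^sub>m y\<^sub>m / y\<^sub>c\<close> for the pivot column \<open>c\<close> of row \<open>i\<close>.\<close>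

definition x_exp :: "nat \<Rightarrow> nat \<Rightarrow> var \<Rightarrow>\<^sub>0 int" where
  "x_exp i m = unit_exp (X i m) + y_exp m - y_exp (c i)"

text \<open>All \<open>y\<^sub>j\<close> and all \<open>x\<^sub>i\<^sub>j\<close> off the pivots are monomials, and the pivot entry of row \<open>i\<close> is determined
  by the equation \<open>\<Sum>\<^sub>m x\<^sub>i\<^sub>m y\<^sub>m = 0\<close>. The division is possible because the \<open>y\<close>-coordinates are
  units.\<close>

definition point :: "var \<Rightarrow> (var \<Rightarrow>\<^sub>0 int) \<Rightarrow>\<^sub>0 'a::field" where
  "point v = (case v of
       Y j \<Rightarrow> Poly_Mapping.single (y_exp j) 1
     | X i j \<Rightarrow> if j = c i then - (\<Sum>m\<in>{1..n} - {c i}. Poly_Mapping.single (x_exp i m) 1)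
         else Poly_Mapping.single (unit_exp (X i j)) 1)"

lemma c_range: "c i \<in> {1..n}"
  using c_ge[of i] c_le[of i] t_less by auto

lemma point_zero:
  "(\<Sum>m=1..n. point (X i m) * point (Y m)) = (0 :: (var \<Rightarrow>\<^sub>0 int) \<Rightarrow>\<^sub>0 'a::field)"
proof -
  let ?s = "\<lambda>g. Poly_Mapping.single g 1 :: (var \<Rightarrow>\<^sub>0 int) \<Rightarrow>\<^sub>0 'a"
  have "point (X i (c i)) * point (Y (c i)) = - (\<Sum>m\<in>{1..n} - {c i}. ?s (x_exp i m) * ?s (y_exp (c i)))"
    by (simp add: point_def sum_distrib_right)
  also have "\<dots> = - (\<Sum>m\<in>{1..n} - {c i}. point (X i m) * point (Y m))"
    by (intro arg_cong[of _ _ uminus] sum.cong) (auto simp: point_def mult_single x_exp_def)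
  finally show ?thesis using c_range[of i] by (subst sum.remove[of _ "c i"]) auto
qed

lemma r_strict:
  assumes "d < e" "e \<le> t" shows "r d < r e"
  by (rule chain_strict[of t r]) (use r_less assms in auto)

lemma y_exp_diff:
  assumes "p \<le> q" "q \<le> Suc t"
  shows "y_exp p - y_exp q = (\<Sum>d\<in>{p..<q}. unit_exp (X (r d) (Suc d)) - unit_exp (X (r d) d))"
proof -
  let ?D = "\<lambda>d. unit_exp (X (r d) (Suc d)) - unit_exp (X (r d) d)"
  have y: "y_exp j = unit_exp (Y (Suc t)) + sum ?D {j..<Suc t}" if "j \<le> Suc t" for j
  proof (cases "j = Suc t")
    case False
    with that have "j \<le> t" by simp
    then show ?thesis unfolding y_exp_def by (simp only: if_True)
  qed (simp add: y_exp_def)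
  have p: "p \<le> Suc t" using assms by simp
  show ?thesis
    unfolding y[OF p] y[OF assms(2)] sum.atLeastLessThan_concat[OF assms, of ?D, symmetric]
    by (simp only: add_diff_cancel_left add_diff_cancel_right')
qed

text \<open>The differences are sums of \<open>x\<^sub>i\<^sub>,\<^sub>d\<^sub>+\<^sub>1 / x\<^sub>i\<^sub>d\<close> with \<open>i = r d\<close>, written additively, and the
  largest variable in them is the denominator for \<open>d = p\<close>, since it lies in the topmost row
  and there to the left of the numerator.\<close>

lemma lookup_y_exp_diff:
  assumes pq: "p < q" "q \<le> Suc t"
  shows "v < X (r p) p \<Longrightarrow> Poly_Mapping.lookup (y_exp p - y_exp q) v = 0"
    and "Poly_Mapping.lookup (y_exp p - y_exp q) (X (r p) p) = -1"
proof -
  have eq: "Poly_Mapping.lookup (y_exp p - y_exp q) v =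
      (\<Sum>d\<in>{p..<q}. (if X (r d) (Suc d) = v then 1 else 0) - (if X (r d) d = v then 1 else 0))" for v
    unfolding y_exp_diff[OF less_imp_le[OF pq(1)] pq(2)] lookup_sum lookup_minus
    by (intro sum.cong refl) (auto simp: lookup_single)
  have rp: "r p < r d" if "p < d" "d < q" for d using r_strict[of p d] that pq by simp
  have ge: "X (r p) p \<le> X (r d) d \<and> X (r p) p < X (r d) (Suc d)" if "d \<in> {p..<q}" for d
    using that rp[of d] by (cases "d = p") (auto simp: less_eq_var_def)
  show "Poly_Mapping.lookup (y_exp p - y_exp q) v = 0" if "v < X (r p) p"
    unfolding eq using that ge by (intro sum.neutral ballI) (smt (verit) leD less_le_trans less_trans less_irrefl)
  have "Poly_Mapping.lookup (y_exp p - y_exp q) (X (r p) p) = (\<Sum>d\<in>{p..<q}. if d = p then -1 else 0)"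
    unfolding eq using rp by (intro sum.cong refl) force
  then show "Poly_Mapping.lookup (y_exp p - y_exp q) (X (r p) p) = -1"
    using pq by simp
qed

lemma lookup_y_exp_Y:
  "Poly_Mapping.lookup (y_exp m) (Y j) = (if j = max m (Suc t) then 1 else 0)"
  by (auto simp: y_exp_def lookup_add lookup_sum lookup_minus lookup_single when_def max_def)

text \<open>For \<open>m < c i\<close> the sign is decided by a denominator in the chosen row \<open>r m\<close> above row \<open>i\<close>, for
  \<open>m > t + 1\<close> by \<open>y\<^sub>t\<^sub>+\<^sub>1\<close> in the denominator.\<close>

lemma x_exp_negative:
  assumes i: "1 \<le> i" and m: "1 \<le> m" "m < c i \<or> Suc t < m"
  shows "x_exp i m < 0"
  using m(2)
proof
  assume mc: "m < c i"
  have "r m \<le> r (c i - 1)"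
  proof (cases "m = c i - 1")
    case False
    then have "m < c i - 1" "c i - 1 \<le> t" using mc c_le[of i] by linarith+
    then show ?thesis by (rule r_strict[THEN less_imp_le])
  qed simp
  then have rm: "r m < i" using c_gt[OF i] by simp
  have eq: "x_exp i m = unit_exp (X i m) + (y_exp m - y_exp (c i))" by (simp add: x_exp_def)
  show ?thesis unfolding exponent_less_iff
  proof (intro exI[of _ "X (r m) m"] conjI allI impI)
    show "Poly_Mapping.lookup (x_exp i m) (X (r m) m) < Poly_Mapping.lookup 0 (X (r m) m)"
      unfolding eq lookup_add lookup_y_exp_diff(2)[OF mc c_le] using rm by (simp add: lookup_single)
    fix w assume w: "w < X (r m) m"
    then have "w \<noteq> X i m" using rm by auto
    then show "Poly_Mapping.lookup (x_exp i m) w = Poly_Mapping.lookup 0 w"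
      unfolding eq lookup_add lookup_y_exp_diff(1)[OF mc c_le w] by (simp add: lookup_single)
  qed
next
  assume mt: "Suc t < m"
  have "max m (Suc t) = m" "max (c i) (Suc t) = Suc t" using mt c_le[of i] by auto
  then have l: "Poly_Mapping.lookup (x_exp i m) (Y j) = (if j = m then 1 else 0) - (if j = Suc t then 1 else 0)" for j
    unfolding x_exp_def lookup_minus lookup_add lookup_y_exp_Y by (simp add: lookup_single)
  show ?thesis unfolding exponent_less_iff
  proof (intro exI[of _ "Y (Suc t)"] conjI allI impI)
    show "Poly_Mapping.lookup (x_exp i m) (Y (Suc t)) < Poly_Mapping.lookup 0 (Y (Suc t))"
      using mt by (simp add: l)
    fix w assume "w < Y (Suc t)"
    then obtain j where "w = Y j" "j < Suc t" by (cases w) auto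
    then show "Poly_Mapping.lookup (x_exp i m) w = Poly_Mapping.lookup 0 w" using mt by (simp add: l)
  qed
qed

text \<open>In the remaining columns only \<open>x\<^sub>i\<^sub>m\<close> and variables in rows from \<open>r (c i) \<ge> i\<close> on occur, none of
  them larger than the pivot variable.\<close>

lemma lookup_x_exp_small:
  assumes i: "1 \<le> i" and m: "c i < m" "m \<le> Suc t" and w: "w < X i (c i)"
  shows "Poly_Mapping.lookup (x_exp i m) w = 0"
proof -
  have "i \<le> r (c i)" using m by (intro c_row) simp
  then have "X i (c i) \<le> X (r (c i)) (c i)" by (auto simp: less_eq_var_def)
  with w have w': "w < X (r (c i)) (c i)" by (rule less_le_trans)
  have "w \<noteq> X i m" using w m by auto
  moreover have "x_exp i m = unit_exp (X i m) - (y_exp (c i) - y_exp m)" by (simp add: x_exp_def)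
  ultimately show ?thesis
    by (simp only: lookup_minus[of "unit_exp (X i m)"] lookup_y_exp_diff(1)[OF m w'])
      (simp add: lookup_single)
qed

lemma cutoff_x_exp:
  assumes i: "1 \<le> i" and m: "1 \<le> m" "m \<noteq> c i" and w: "w < X i (c i)"
  shows "cutoff w (x_exp i m) \<le> 0"
proof (cases "m < c i \<or> Suc t < m")
  case True
  from cutoff_mono[OF less_imp_le[OF x_exp_negative[OF i m(1) this]], of w]
  show ?thesis by (simp add: cutoff_zero)
next
  case False
  then have m': "c i < m" "m \<le> Suc t" using m by auto
  have "cutoff w (x_exp i m) = 0"
    using lookup_x_exp_small[OF i m'] w by (intro poly_mapping_eqI) (auto intro: le_less_trans)
  then show ?thesis by simp
qed

lemma unit_exp_pos: "0 < (unit_exp v :: var \<Rightarrow>\<^sub>0 int)"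
  unfolding exponent_less_iff by (intro exI[of _ v]) (auto simp: lookup_single when_def)

text \<open>At a chosen row the choice of the exponents of the \<open>y\<^sub>j\<close> makes the summand of the next column the
  unique one with the exponent of the pivot variable; all others are smaller.\<close>

lemma x_exp_top:
  assumes ct: "c (r e) = e" "e \<le> t" and re: "1 \<le> r e"
  shows "x_exp (r e) (Suc e) = unit_exp (X (r e) e)"
    and "1 \<le> m \<Longrightarrow> m \<noteq> e \<Longrightarrow> m \<noteq> Suc e \<Longrightarrow> x_exp (r e) m < unit_exp (X (r e) e)"
proof -
  have d: "y_exp e - y_exp (Suc e) = unit_exp (X (r e) (Suc e)) - unit_exp (X (r e) e)"
    using ct by (subst y_exp_diff) auto
  then show "x_exp (r e) (Suc e) = unit_exp (X (r e) e)"
    unfolding x_exp_def ct(1) by (simp add: algebra_simps)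
  assume m: "1 \<le> m" "m \<noteq> e" "m \<noteq> Suc e"
  show "x_exp (r e) m < unit_exp (X (r e) e)"
  proof (cases "m < c (r e) \<or> Suc t < m")
    case True
    from x_exp_negative[OF re m(1) this] unit_exp_pos show ?thesis by (rule less_trans)
  next
    case False
    then have m': "Suc e < m" "m \<le> Suc t" using m ct by auto
    have "r e < r (Suc e)" using r_less[of e] m' by simp
    then have less: "X (r e) (Suc e) < X (r (Suc e)) (Suc e)" by simp
    have eq: "x_exp (r e) m = unit_exp (X (r e) m) - (y_exp (Suc e) - y_exp m)
        - unit_exp (X (r e) (Suc e)) + unit_exp (X (r e) e)"
      using d unfolding x_exp_def ct(1) by (simp add: algebra_simps)
    show ?thesis unfolding exponent_less_iff
    proof (intro exI[of _ "X (r e) (Suc e)"] conjI allI impI)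
      have "Poly_Mapping.lookup (y_exp (Suc e) - y_exp m) w = 0" if "w \<le> X (r e) (Suc e)" for w
        using lookup_y_exp_diff(1)[OF m' le_less_trans[OF that less]] .
      note y = this
      show "Poly_Mapping.lookup (x_exp (r e) m) (X (r e) (Suc e))
          < Poly_Mapping.lookup (unit_exp (X (r e) e)) (X (r e) (Suc e))"
        unfolding eq lookup_add lookup_minus[of _ "unit_exp (X (r e) (Suc e))"]
          lookup_minus[of "unit_exp (X (r e) m)"] y[OF order_refl] using m by (simp add: lookup_single)
      fix w assume w: "w < X (r e) (Suc e)"
      then have "w \<noteq> X (r e) m" "w \<noteq> X (r e) (Suc e)" using m' by auto
      then show "Poly_Mapping.lookup (x_exp (r e) m) w = Poly_Mapping.lookup (unit_exp (X (r e) e)) w"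
        unfolding eq lookup_add lookup_minus[of _ "unit_exp (X (r e) (Suc e))"]
          lookup_minus[of "unit_exp (X (r e) m)"] y[OF less_imp_le[OF w]] by (simp add: lookup_single)
    qed
  qed
qed

lemma keys_point_pivot:
  assumes "\<kappa> \<in> Poly_Mapping.keys (point (X i (c i)) :: (var \<Rightarrow>\<^sub>0 int) \<Rightarrow>\<^sub>0 'a::field)"
  obtains m where "1 \<le> m" "m \<le> n" "m \<noteq> c i" "\<kappa> = x_exp i m"
proof -
  let ?f = "\<lambda>m. Poly_Mapping.single (x_exp i m) (1 :: 'a)"
  have "\<kappa> \<in> Poly_Mapping.keys (\<Sum>m\<in>{1..n} - {c i}. ?f m)"
    using assms by (simp add: point_def in_keys_iff)
  with keys_sum[of ?f "{1..n} - {c i}"]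
  have "\<kappa> \<in> (\<Union>m\<in>{1..n} - {c i}. Poly_Mapping.keys (?f m))" by (rule subsetD)
  then obtain m where "m \<in> {1..n} - {c i}" "\<kappa> \<in> Poly_Mapping.keys (?f m)" by blast
  then show thesis by (intro that[of m]) auto
qed

lemma lookup_point_top:
  assumes ct: "c (r e) = e" "e \<le> t" and re: "1 \<le> r e"
  shows "Poly_Mapping.lookup (point (X (r e) e) :: (var \<Rightarrow>\<^sub>0 int) \<Rightarrow>\<^sub>0 'a::field) (unit_exp (X (r e) e)) = -1"
proof -
  have "point (X (r e) e) = - (\<Sum>m\<in>{1..n} - {e}. Poly_Mapping.single (x_exp (r e) m) (1 :: 'a))"
    using ct by (simp add: point_def)
  then have "Poly_Mapping.lookup (point (X (r e) e)) (unit_exp (X (r e) e)) =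
      - (\<Sum>m\<in>{1..n} - {e}. Poly_Mapping.lookup (Poly_Mapping.single (x_exp (r e) m) (1 :: 'a)) (unit_exp (X (r e) e)))"
    by (simp add: lookup_sum)
  also have "\<dots> = - (\<Sum>m\<in>{1..n} - {e}. if m = Suc e then 1 else 0)"
  proof (intro arg_cong[of _ _ uminus] sum.cong refl)
    fix m assume "m \<in> {1..n} - {e}"
    then show "Poly_Mapping.lookup (Poly_Mapping.single (x_exp (r e) m) (1 :: 'a)) (unit_exp (X (r e) e))
        = (if m = Suc e then 1 else 0)"
      using x_exp_top(1)[OF assms] x_exp_top(2)[OF assms, of m]
      by (cases "m = Suc e") (auto simp: lookup_single when_def)
  qed
  also have "\<dots> = -1" using ct t_less by simp
  finally show ?thesis .
qed

end


section \<open>Leading monomials of the ideal\<close>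

text \<open>The polynomials of level \<open>k\<close> do not contain \<open>y\<^sub>j\<close> with \<open>j < k\<close>, so these coordinates of a point may
  be replaced by the variables themselves.\<close>

definition free_point ::
  "nat \<Rightarrow> (var \<Rightarrow> (var \<Rightarrow>\<^sub>0 int) \<Rightarrow>\<^sub>0 'a::field) \<Rightarrow> var \<Rightarrow> (var \<Rightarrow>\<^sub>0 int) \<Rightarrow>\<^sub>0 'a" where
  "free_point k P v = (case v of
       Y j \<Rightarrow> if j < k then Poly_Mapping.single (unit_exp (Y j)) 1 else P v
     | X i j \<Rightarrow> P v)"

text \<open>The generators of level \<open>k\<close> lie in the ideal of level \<open>1\<close>, which is generated by the entries of
  \<open>XY\<close>, and do not see the replaced coordinates.\<close>

lemma poly_eval_Itilde:
  assumes P: "\<And>i. (\<Sum>m=1..n. P (X i m) * P (Y m)) = 0"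
    and k: "1 \<le> k" "k \<le> n" and f: "f \<in> Itilde n k"
  shows "poly_eval (free_point k P) f = (0 :: (var \<Rightarrow>\<^sub>0 int) \<Rightarrow>\<^sub>0 'a::field)"
proof -
  have n: "1 \<le> n" using k by simp
  have "Stilde n 1 \<subseteq> {p \<in> carrier (Rhat n). poly_eval P p = 0}"
  proof
    fix p :: "(var, 'a) mpoly" assume p: "p \<in> Stilde n 1"
    then obtain i where i: "1 \<le> i" "i \<le> n + 1" "p = Xtilde n 1 [i]" by (auto simp: Stilde_def C_one[unfolded One_nat_def])
    have "poly_eval P p = (\<Sum>m=1..n. P (X i m) * P (Y m))"
      unfolding i(3) Xtilde_one[OF i(1,2)] by (simp add: poly_eval_sum poly_eval_mult poly_eval_indet)
    then show "p \<in> {p \<in> carrier (Rhat n). poly_eval P p = 0}"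
      using Stilde_carrier[of 1 n] p n P by auto
  qed
  from Idl_mpoly_ring_minimal[OF ideal_eval_kernel this]
  have one: "poly_eval P p = 0" if "p \<in> Itilde n 1" for p
    using that unfolding Itilde_def by blast
  have "Stilde n k \<subseteq> {p \<in> carrier (Rhat n). poly_eval (free_point k P) p = 0}"
  proof
    fix p :: "(var, 'a) mpoly" assume p: "p \<in> Stilde n k"
    then obtain as where as: "as \<in> C n k" "p = Xtilde n k as" by (auto simp: Stilde_def)
    have "poly_eval (free_point k P) p = poly_eval P p"
    proof (rule poly_eval_cong)
      fix m v assume m: "m \<in> Poly_Mapping.keys p" "v \<in> Poly_Mapping.keys m"
      obtain l q where "k \<le> l" "m = xmonom k as l q"
        using keys_Xtilde[OF as(1) k m(1)[unfolded as(2)]] by metis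
      then show "free_point k P v = P v"
        using m(2) by (cases v) (auto simp: free_point_def in_keys_iff lookup_xmonom_Y split: if_splits)
    qed
    also have "\<dots> = 0"
      using p Itilde_ideal(2)[OF k] Itilde_antimono[OF k(1) order_refl k(2)] by (intro one) blast
    finally show "p \<in> {p \<in> carrier (Rhat n). poly_eval (free_point k P) p = 0}"
      using p Stilde_carrier[OF k] by blast
  qed
  from Idl_mpoly_ring_minimal[OF ideal_eval_kernel this] f
  show ?thesis unfolding Itilde_def by blast
qed

lemma Itilde_key_Y:
  assumes k: "1 \<le> k" "k \<le> n" and f: "f \<in> (Itilde n k :: (var, 'a::field) mpoly set)"
    and m: "m \<in> Poly_Mapping.keys f"
  obtains j where "k \<le> j" "j \<le> n" "Y j \<in> Poly_Mapping.keys m"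
proof -
  let ?M = "(\<lambda>j. Poly_Mapping.single (Y j) 1) ` {k..n}"
  have "(Stilde n k :: (var, 'a) mpoly set)
     \<subseteq> {p \<in> carrier (Rhat n). \<forall>m\<in>Poly_Mapping.keys p. \<exists>s\<in>?M. \<exists>d. m = s + d}"
  proof
    fix p :: "(var, 'a) mpoly" assume p: "p \<in> Stilde n k"
    then obtain as where as: "as \<in> C n k" "p = Xtilde n k as" by (auto simp: Stilde_def)
    have "\<exists>s\<in>?M. \<exists>d. m = s + d" if m: "m \<in> Poly_Mapping.keys p" for m
    proof -
      obtain l q where "k \<le> l" "l \<le> n" "m = xmonom k as l q"
        using keys_Xtilde[OF as(1) k m[unfolded as(2)]] by metis
      moreover from this have "m = Poly_Mapping.single (Y l) 1 +
          (\<Sum>i<k. Poly_Mapping.single (X (as ! i) (mcol k l (q i))) 1)"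
        unfolding xmonom_def by (simp only: add.commute)
      ultimately show ?thesis by fastforce
    qed
    then show "p \<in> {p \<in> carrier (Rhat n). \<forall>m\<in>Poly_Mapping.keys p. \<exists>s\<in>?M. \<exists>d. m = s + d}"
      using p Stilde_carrier[OF k] by blast
  qed
  from Idl_mpoly_ring_minimal[OF ideal_monomial_multiples this] f m
  have "\<exists>s\<in>?M. \<exists>d. m = s + d" unfolding Itilde_def by blast
  then obtain j d where "j \<in> {k..n}" "m = Poly_Mapping.single (Y j) 1 + d" by blast
  then show thesis by (intro that[of j]) (auto simp: keys_add_monom)
qed

lemma monom_dvdI:
  fixes s u :: "'v monom"
  assumes "\<And>v. Poly_Mapping.lookup s v \<le> Poly_Mapping.lookup u v"
  shows "u = s + (u - s)"
  using assms by (intro poly_mapping_eqI) (simp add: lookup_add lookup_minus)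

lemma lead_xmonom_dvd:
  assumes as: "as \<in> C n k" and Y: "Y k \<in> Poly_Mapping.keys u"
    and X: "\<And>d. d < k \<Longrightarrow> X (as ! d) (Suc d) \<in> Poly_Mapping.keys u"
  shows "\<exists>d. u = lead_xmonom k as + d"
proof -
  have "Poly_Mapping.lookup (lead_xmonom k as) v \<le> Poly_Mapping.lookup u v" for v
  proof (cases v)
    case (Y j)
    then show ?thesis using \<open>Y k \<in> Poly_Mapping.keys u\<close>
      by (auto simp: lookup_xmonom_Y in_keys_iff)
  next
    case v: (X i j)
    show ?thesis
    proof (cases "Poly_Mapping.lookup (lead_xmonom k as) (X i j) = 0")
      case False
      then obtain d where d: "d < k" "i = as ! d" "j = Suc d"
        using lookup_xmonom_X_nonzero[OF False] by (auto simp: mcol_diag)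
      from X[OF d(1)] show ?thesis
        unfolding v d(2,3) lookup_xmonom_X_nth[OF as d(1)] by (auto simp: in_keys_iff)
    qed (simp add: v)
  qed
  then show ?thesis using monom_dvdI by blast
qed

text \<open>Suppose that no leading monomial of the basis divides the leading monomial \<open>u\<close> of \<open>f\<close>, and run
  the greedy choice on the \<open>x\<close>-variables of \<open>u\<close>. The chain it finds shows that
  \<open>y\<^sub>j\<close> does not divide \<open>u\<close> for \<open>k \<le> j \<le> t\<close>. So the variables of \<open>u\<close> are sent to Laurent
  polynomials with the correct leading exponent, and the criterion for not vanishing applies. But
  \<open>f\<close> vanishes at the point.\<close>

theorem lead_monom_Itilde:
  assumes k: "1 \<le> k" "k \<le> n" and f: "f \<in> (Itilde n k :: (var, 'a::field) mpoly set)" "f \<noteq> 0"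
  shows "\<exists>g\<in>(Gset n k :: (var, 'a) mpoly set). \<exists>d. lead_monom f = lead_monom g + d"
proof (rule ccontr)
  assume no: "\<not> ?thesis"
  define u where "u = lead_monom f"
  have u: "u \<in> Poly_Mapping.keys f" using f(2) unfolding u_def lead_monom_def by (intro Max_in) auto
  have f_carr: "f \<in> carrier (Rhat n)" using ideal_mpoly_ringD(1)[OF Itilde_ideal(1)[OF k] f(1)] .
  have uV: "Poly_Mapping.keys u \<subseteq> vars n" using u f_carr by (auto simp: carrier_mpoly_ring)
  define S where "S = (\<lambda>i j. X i j \<in> Poly_Mapping.keys u)"
  have SV: "1 \<le> i \<and> i \<le> n + 1 \<and> j \<le> n" if "S i j" for i j
    using that uV by (auto simp: S_def vars_def)
  have S_col: "j \<le> n" if "S i j" for i j using SV[OF that] by simp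
  obtain t r c where r_less: "\<And>d. d < t \<Longrightarrow> r d < r (Suc d)"
    and r_S: "\<And>d. d < t \<Longrightarrow> S (r (Suc d)) (Suc d)"
    and c: "\<And>i. 1 \<le> c i" "\<And>i. c i \<le> Suc t" "\<And>i. 1 \<le> i \<Longrightarrow> r (c i - 1) < i"
      "\<And>i. c i \<le> t \<Longrightarrow> i \<le> r (c i)"
    and diag: "\<And>i. 1 \<le> i \<Longrightarrow> S i (c i) \<Longrightarrow> c i \<le> t \<and> i = r (c i)"
    by (rule greedy_chain[of S n], erule S_col, rule that)
  have r_mono: "r d < r e" if "d < e" "e \<le> t" for d e
    by (rule chain_strict[of t r]) (use r_less that in auto)
  have Y_t: "t < j" if j: "Y j \<in> Poly_Mapping.keys u" "k \<le> j" "j \<le> n" for j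
  proof (rule ccontr)
    assume "\<not> t < j"
    then have jt: "j \<le> t" by simp
    \<comment> \<open>The first \<open>j\<close> chosen rows would give an element of the basis whose leading monomial divides \<open>u\<close>.\<close>
    define as where "as = map (\<lambda>d. r (Suc d)) [0..<j]"
    have nth: "as ! d = r (Suc d)" if "d < j" for d using that by (simp add: as_def)
    have "as \<in> C n j"
      using SV[OF r_S] r_mono jt by (auto simp: C_def as_def sorted_wrt_iff_nth_less)
    moreover have "\<exists>d. u = lead_xmonom j as + d"
      using \<open>as \<in> C n j\<close> j(1)
    proof (rule lead_xmonom_dvd)
      show "X (as ! d) (Suc d) \<in> Poly_Mapping.keys u" if "d < j" for d
        using r_S[of d] that jt by (simp add: nth S_def)
    qed
    moreover have "1 \<le> j" using j k by simp
    ultimately have "Xtilde n j as \<in> (Gset n k :: (var, 'a) mpoly set)"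
        "\<exists>d. u = lead_monom (Xtilde n j as :: (var, 'a) mpoly) + d"
      using j lead_Xtilde(1)[of as n j, where 'a = 'a] by (auto simp: Gset_def Stilde_def)
    with no show False unfolding u_def by blast
  qed
  \<comment> \<open>Every monomial of \<open>f\<close> contains some \<open>y\<^sub>j\<close> with \<open>k \<le> j \<le> n\<close>, so the chain is not of full length.\<close>
  obtain j where "k \<le> j" "j \<le> n" "Y j \<in> Poly_Mapping.keys u"
    using Itilde_key_Y[OF k f(1) u] .
  with Y_t[of j] have "t < n" by simp
  then interpret staircase n t r c
    using r_less c by unfold_locales
  let ?P = "free_point k point :: var \<Rightarrow> (var \<Rightarrow>\<^sub>0 int) \<Rightarrow>\<^sub>0 'a"
  have X_other: "?P (X i j) = Poly_Mapping.single (unit_exp (X i j)) 1" if "j \<noteq> c i" for i j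
    using that by (simp add: free_point_def point_def)
  have X_pivot: "?P (X i (c i)) = point (X i (c i))" for i by (simp add: free_point_def)
  have Y_other: "?P (Y j) = Poly_Mapping.single (unit_exp (Y j)) 1" if "j < k \<or> t < j" for j
    using that by (auto simp: free_point_def point_def y_exp_def)
  have Y_small: "?P (Y j) = Poly_Mapping.single (y_exp j) 1" if "\<not> (j < k \<or> t < j)" for j
    using that by (auto simp: free_point_def point_def)
  have key_u: "?P v = Poly_Mapping.single (unit_exp v) 1 \<or> (\<exists>e. v = X (r e) e \<and> c (r e) = e \<and> e \<le> t \<and> 1 \<le> r e)"
    if v: "v \<in> Poly_Mapping.keys u" for v
  proof (cases v)
    case (Y j)
    then have "j \<le> n" using v uV by (auto simp: vars_def)
    then have "j < k \<or> t < j" using Y_t[of j] v Y by fastforce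
    then show ?thesis using Y_other Y by blast
  next
    case (X i j)
    show ?thesis
    proof (cases "j = c i")
      case True
      have "S i (c i)" "1 \<le> i" using v X True SV[of i j] by (auto simp: S_def)
      with diag[of i] True X show ?thesis by auto
    qed (use X X_other in simp)
  qed
  have "poly_eval ?P f \<noteq> 0"
    using f_carr f(2)
  proof (rule poly_eval_nonzero, unfold u_def[symmetric])
    fix v \<kappa> assume v: "v \<in> Poly_Mapping.keys u" and \<kappa>: "\<kappa> \<in> Poly_Mapping.keys (?P v)"
    from key_u[OF v] show "\<kappa> \<le> unit_exp v"
    proof
      assume "?P v = Poly_Mapping.single (unit_exp v) 1"
      with \<kappa> show ?thesis by simp
    next
      assume "\<exists>e. v = X (r e) e \<and> c (r e) = e \<and> e \<le> t \<and> 1 \<le> r e"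
      then obtain e where e: "v = X (r e) e" "c (r e) = e" "e \<le> t" "1 \<le> r e" by blast
      have "\<kappa> \<in> Poly_Mapping.keys (point (X (r e) (c (r e))) :: (var \<Rightarrow>\<^sub>0 int) \<Rightarrow>\<^sub>0 'a)"
        using \<kappa> X_pivot[of "r e"] e by simp
      then obtain m where m: "1 \<le> m" "m \<noteq> e" "\<kappa> = x_exp (r e) m"
        using keys_point_pivot e(2) by metis
      show ?thesis using x_exp_top(1)[OF e(2-4)] x_exp_top(2)[OF e(2-4), of m] m e(1) by (cases "m = Suc e") auto
    qed
  next
    fix v assume v: "v \<in> Poly_Mapping.keys u"
    from key_u[OF v] show "Poly_Mapping.lookup (?P v) (unit_exp v) \<noteq> 0"
    proof
      assume "\<exists>e. v = X (r e) e \<and> c (r e) = e \<and> e \<le> t \<and> 1 \<le> r e"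
      then obtain e where e: "v = X (r e) e" "c (r e) = e" "e \<le> t" "1 \<le> r e" by blast
      then have "?P v = point (X (r e) e)" using X_pivot[of "r e"] by simp
      then show ?thesis using lookup_point_top[OF e(2-4), where 'a = 'a] e(1) by simp
    qed simp
  next
    fix v w \<kappa> assume v: "v \<in> vars n" and w: "w < v" and \<kappa>: "\<kappa> \<in> Poly_Mapping.keys (?P v)"
    have unit: "cutoff w (unit_exp v) = 0"
      using w by (intro poly_mapping_eqI) (auto simp: lookup_single when_def)
    show "cutoff w \<kappa> \<le> 0"
    proof (cases v)
      case (Y j)
      show ?thesis
      proof (cases "j < k \<or> t < j")
        case True
        then show ?thesis using \<kappa> Y_other Y unit by simp
      next
        case False
        then have \<kappa>': "\<kappa> = y_exp j" using \<kappa> Y_small Y by simp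
        have "Poly_Mapping.lookup (y_exp j) x = 0" if "x \<le> w" for x
        proof -
          have "x < Y j" using that w Y by simp
          then obtain l where "x = Y l" "l < j" by (cases x) auto
          then show ?thesis using False by (simp add: lookup_y_exp_Y)
        qed
        then have "cutoff w \<kappa> = 0" unfolding \<kappa>' by (intro poly_mapping_eqI) auto
        then show ?thesis by simp
      qed
    next
      case (X i j)
      show ?thesis
      proof (cases "j = c i")
        case True
        have i: "1 \<le> i" using v X by (auto simp: vars_def)
        obtain m where "1 \<le> m" "m \<noteq> c i" "\<kappa> = x_exp i m"
          using keys_point_pivot \<kappa> X_pivot X True by metis
        then show ?thesis using cutoff_x_exp[OF i] w X True by blast
      next
        case False
        then show ?thesis using \<kappa> X_other X unit by simp
      qed
    qed
  qed
  moreover have "poly_eval ?P f = 0"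
    using point_zero k f(1) by (intro poly_eval_Itilde)
  ultimately show False by simp
qed

lemma Gset_element:
  assumes "g \<in> Gset n k" "1 \<le> k"
  obtains l as where "1 \<le> l" "k \<le> l" "l \<le> n" "as \<in> C n l" "g = Xtilde n l as"
  using assms by (auto simp: Gset_def Stilde_def)

lemma finite_C: "finite (C n k)"
  by (rule finite_subset[OF _ finite_lists_length_eq[of "{1..n+1}" k]]) (auto simp: C_def)

lemma reduced_groebner_basis_Itilde:
  assumes k: "1 \<le> k" "k \<le> n"
  shows "reduced_groebner_basis (vars n) (Itilde n k :: (var, 'a::field) mpoly set) (Gset n k)"
proof (rule reduced_groebner_basisI)
  show "ideal (Itilde n k :: (var, 'a) mpoly set) (Rhat n)" by (rule Itilde_ideal[OF k])
  show "finite (Gset n k :: (var, 'a) mpoly set)"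
    unfolding Gset_def Stilde_def using finite_C by auto
  show "(Gset n k :: (var, 'a) mpoly set) \<subseteq> Itilde n k" by (rule Gset_subset_Itilde[OF k])
  show "lead_coef g = 1" if g: "g \<in> Gset n k" for g :: "(var, 'a) mpoly"
    using Gset_element[OF g k(1)] lead_Xtilde(2) by metis
  show "\<exists>g\<in>(Gset n k :: (var, 'a) mpoly set). \<exists>d. lead_monom f = lead_monom g + d"
    if "f \<in> Itilde n k" "f \<noteq> 0" for f :: "(var, 'a) mpoly"
    using lead_monom_Itilde[OF k that] .
  fix g h :: "(var, 'a) mpoly" and m d
  assume g: "g \<in> Gset n k" and h: "h \<in> Gset n k" and m: "m \<in> Poly_Mapping.keys g"
    and dvd: "m = lead_monom h + d"
  obtain l as where l: "1 \<le> l" "l \<le> n" "as \<in> C n l" "g = Xtilde n l as"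
    using Gset_element[OF g k(1)] by metis
  obtain l' bs where l': "1 \<le> l'" "l' \<le> n" "bs \<in> C n l'" "h = Xtilde n l' bs"
    using Gset_element[OF h k(1)] by metis
  have "l = l' \<and> as = bs"
  proof (rule lead_Xtilde_dvd_key[OF l(3,1,2) l'(3,1,2)])
    show "m \<in> Poly_Mapping.keys (Xtilde n l as :: (var, 'a) mpoly)" using m l(4) by simp
    show "m = lead_xmonom l' bs + d" using dvd lead_Xtilde(1)[OF l'(3,1,2), where 'a = 'a] l'(4) by simp
  qed
  then show "g = h" using l l' by simp
qed

theorem theorem5p1:
  fixes n :: nat
  assumes "n \<ge> 1"
  shows "(\<forall>k\<in>{1..n}. reduced_groebner_basis (vars n)
            (Itilde n k :: (var, 'a::field) mpoly set) (Gset n k))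
       \<and> (Itilde n 1 :: (var, 'a) mpoly set) = I1_XY n
       \<and> reduced_groebner_basis (vars n) (I1_XY n :: (var, 'a) mpoly set) (Gset n 1)"
  using reduced_groebner_basis_Itilde[of _ n, where 'a = 'a] assms
  unfolding Itilde_one[symmetric] by auto

end
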